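(* For any metric $M=(X,d)$ with doubling dimension $\mathrm{dim}(M)$, there exists a polynomial-time $O(2^{3\cdot\mathrm{dim}(M)})$-approximation algorithm for the connected $k$-center problem with disjoint clusters and for the connected $k$-diameter problem with disjoint clusters (on instances whose point set is $X$ with metric $d$).
   Context: An instance consists of a finite point set $V$, a metric $d$ on $V$, an integer $k\ge1$, and an unweighted undirected connectivity graph $G=(V,E)$. A feasible solution (disjoint clusters) is a partition of $V$ into $k$ clusters $C_1,\dots,C_k$, each inducing a connected subgraph of $G$. For connected $k$-center, centers $c_i\in C_i$ are also chosen and the cost is $\max_i\max_{x\in C_i}d(x,c_i)$; for connected $k$-diameter the cost is $\max_i\max_{x,y\in C_i}d(x,y)$. An $\alpha$-approximation algorithm returns a feasible solution of cost at most $\alpha$ times optimal. The doubling constant of $M=(X,d)$ is the smallest $K$ such that for all $x\in X$ and $\rho>0$ the ball $B_\rho(x)=\{y\in X: d(x,y)\le\rho\}$ is covered by at most $K$ balls of radius $\rho/2$ centered at points of $X$; the doubling dimension is $\mathrm{dim}(M)=\lceil\log_2 K\rceil$. *)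

theory Defs
  imports
    "HOL-Analysis.Analysis"
    "HOL-Library.Landau_Symbols"
    "HOL-Computational_Algebra.Polynomial"
begin

section \<open>Doubling dimension\<close>

definition doubling_constant :: "'a set \<Rightarrow> ('a \<Rightarrow> 'a \<Rightarrow> real) \<Rightarrow> nat" where
  "doubling_constant X d =
     (LEAST K. \<forall>x\<in>X. \<forall>\<rho>>0. \<exists>S\<subseteq>X. finite S \<and> card S \<le> K \<and>
        Metric_space.mcball X d x \<rho> \<subseteq> (\<Union>s\<in>S. Metric_space.mcball X d s (\<rho> / 2)))"

definition doubling_dim :: "'a set \<Rightarrow> ('a \<Rightarrow> 'a \<Rightarrow> real) \<Rightarrow> nat" where
  "doubling_dim X d = nat \<lceil>log 2 (real (doubling_constant X d))\<rceil>"


section \<open>Connected clustering with disjoint clusters\<close>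

text \<open>The edge set of the undirected connectivity graph is a symmetric relation on the points.\<close>

definition clustering_instance ::
    "'a set \<Rightarrow> ('a \<Rightarrow> 'a \<Rightarrow> real) \<Rightarrow> ('a \<times> 'a) set \<Rightarrow> nat \<Rightarrow> bool" where
  "clustering_instance X d E k \<longleftrightarrow>
     finite X \<and> Metric_space X d \<and> E \<subseteq> X \<times> X \<and> sym E \<and> 1 \<le> k"

definition induces_connected :: "('a \<times> 'a) set \<Rightarrow> 'a set \<Rightarrow> bool" where
  "induces_connected E C \<longleftrightarrow> (\<forall>x\<in>C. \<forall>y\<in>C. (x, y) \<in> (Restr E C)\<^sup>*)"

text \<open>The clusters are \<open>C 0, \<dots>, C (k - 1)\<close>; values of \<open>C\<close> at other indices are irrelevant.\<close>

definition connected_clustering ::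
    "'a set \<Rightarrow> ('a \<times> 'a) set \<Rightarrow> nat \<Rightarrow> (nat \<Rightarrow> 'a set) \<Rightarrow> bool" where
  "connected_clustering X E k C \<longleftrightarrow>
     (\<Union>i<k. C i) = X \<and> disjoint_family_on C {..<k} \<and>
     (\<forall>i<k. C i \<noteq> {} \<and> induces_connected E (C i))"

definition connected_center_clustering ::
    "'a set \<Rightarrow> ('a \<times> 'a) set \<Rightarrow> nat \<Rightarrow> (nat \<Rightarrow> 'a set) \<Rightarrow> (nat \<Rightarrow> 'a) \<Rightarrow> bool" where
  "connected_center_clustering X E k C c \<longleftrightarrow>
     connected_clustering X E k C \<and> (\<forall>i<k. c i \<in> C i)"

definition center_cost ::
    "('a \<Rightarrow> 'a \<Rightarrow> real) \<Rightarrow> nat \<Rightarrow> (nat \<Rightarrow> 'a set) \<Rightarrow> (nat \<Rightarrow> 'a) \<Rightarrow> real" where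
  "center_cost d k C c = (MAX i\<in>{..<k}. MAX x\<in>C i. d x (c i))"

definition diameter_cost ::
    "('a \<Rightarrow> 'a \<Rightarrow> real) \<Rightarrow> nat \<Rightarrow> (nat \<Rightarrow> 'a set) \<Rightarrow> real" where
  "diameter_cost d k C = (MAX i\<in>{..<k}. MAX x\<in>C i. MAX y\<in>C i. d x y)"

definition center_opt ::
    "'a set \<Rightarrow> ('a \<Rightarrow> 'a \<Rightarrow> real) \<Rightarrow> ('a \<times> 'a) set \<Rightarrow> nat \<Rightarrow> real" where
  "center_opt X d E k = Min {center_cost d k C c |C c. connected_center_clustering X E k C c}"

definition diameter_opt ::
    "'a set \<Rightarrow> ('a \<Rightarrow> 'a \<Rightarrow> real) \<Rightarrow> ('a \<times> 'a) set \<Rightarrow> nat \<Rightarrow> real" where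
  "diameter_opt X d E k = Min {diameter_cost d k C |C. connected_clustering X E k C}"


section \<open>Algorithms and running time\<close>

text \<open>
  Algorithms are programs of an imperative language over two stores of two-dimensional arrays, one
  of natural numbers (also used for addressing) and one of real numbers. A scalar is an array read
  at fixed indices.

  The available arithmetic is addition, subtraction and comparison, at unit cost, with no
  multiplication and no rounding of reals. Hence the bit length of natural numbers, and on rational
  inputs that of the numerators over a common denominator of the input, grows by at most a constant
  in every step. Polynomially many steps are thus polynomial time in the bit model as well as on a
  real RAM. The only real constants are
  natural numbers, so that a program cannot carry infinitely many bits of advice.
\<close>

type_synonym vname = string

datatype nexp =
    NConst nat
  | NLoad vname nexp nexp
  | NAdd nexp nexp
  | NSub nexp nexp

datatype rexp =
    RConst nat
  | RLoad vname nexp nexp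
  | RAdd rexp rexp
  | RSub rexp rexp

datatype bexp =
    NLess nexp nexp
  | RLess rexp rexp
  | BNot bexp
  | BAnd bexp bexp

datatype com =
    Skip
  | NStore vname nexp nexp nexp
  | RStore vname nexp nexp rexp
  | Seq com com
  | Cond bexp com com
  | While bexp com

record store =
  nmem :: "vname \<Rightarrow> nat \<Rightarrow> nat \<Rightarrow> nat"
  rmem :: "vname \<Rightarrow> nat \<Rightarrow> nat \<Rightarrow> real"

primrec nval :: "nexp \<Rightarrow> store \<Rightarrow> nat" where
  "nval (NConst m) s = m"
| "nval (NLoad a e f) s = nmem s a (nval e s) (nval f s)"
| "nval (NAdd e f) s = nval e s + nval f s"
| "nval (NSub e f) s = nval e s - nval f s"

primrec rval :: "rexp \<Rightarrow> store \<Rightarrow> real" where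
  "rval (RConst m) s = real m"
| "rval (RLoad a e f) s = rmem s a (nval e s) (nval f s)"
| "rval (RAdd e f) s = rval e s + rval f s"
| "rval (RSub e f) s = rval e s - rval f s"

primrec bval :: "bexp \<Rightarrow> store \<Rightarrow> bool" where
  "bval (NLess e f) s \<longleftrightarrow> nval e s < nval f s"
| "bval (RLess e f) s \<longleftrightarrow> rval e s < rval f s"
| "bval (BNot b) s \<longleftrightarrow> \<not> bval b s"
| "bval (BAnd b c) s \<longleftrightarrow> bval b s \<and> bval c s"

definition upd :: "(vname \<Rightarrow> nat \<Rightarrow> nat \<Rightarrow> 'v) \<Rightarrow> vname \<Rightarrow> nat \<Rightarrow> nat \<Rightarrow> 'v
    \<Rightarrow> vname \<Rightarrow> nat \<Rightarrow> nat \<Rightarrow> 'v" where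
  "upd m a i j v = m(a := (m a)(i := (m a i)(j := v)))"

text \<open>
  \<open>exec A s t s'\<close>: program \<open>A\<close> started in \<open>s\<close> terminates in \<open>s'\<close> after \<open>t\<close> steps. Every assignment
  and every test is one step; the expressions of a fixed program have constant size.
\<close>

inductive exec :: "com \<Rightarrow> store \<Rightarrow> nat \<Rightarrow> store \<Rightarrow> bool" where
  Skip: "exec Skip s 1 s"
| NStore: "exec (NStore a e f g) s 1
    (s\<lparr>nmem := upd (nmem s) a (nval e s) (nval f s) (nval g s)\<rparr>)"
| RStore: "exec (RStore a e f r) s 1
    (s\<lparr>rmem := upd (rmem s) a (nval e s) (nval f s) (rval r s)\<rparr>)"
| Seq: "\<lbrakk>exec A s t s'; exec B s' u s''\<rbrakk> \<Longrightarrow> exec (Seq A B) s (t + u) s''"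
| CondTrue: "\<lbrakk>bval b s; exec A s t s'\<rbrakk> \<Longrightarrow> exec (Cond b A B) s (Suc t) s'"
| CondFalse: "\<lbrakk>\<not> bval b s; exec B s t s'\<rbrakk> \<Longrightarrow> exec (Cond b A B) s (Suc t) s'"
| WhileFalse: "\<not> bval b s \<Longrightarrow> exec (While b A) s 1 s"
| WhileTrue: "\<lbrakk>bval b s; exec A s t s'; exec (While b A) s' u s''\<rbrakk>
    \<Longrightarrow> exec (While b A) s (Suc (t + u)) s''"

inductive_cases exec_SkipE: "exec Skip s t s'"
  and exec_NStoreE: "exec (NStore a e f g) s t s'"
  and exec_RStoreE: "exec (RStore a e f r) s t s'"
  and exec_SeqE: "exec (Seq A B) s t s'"
  and exec_CondE: "exec (Cond b A B) s t s'"
  and exec_WhileE: "exec (While b A) s t s'"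

lemma exec_deterministic:
  "exec A s t s' \<Longrightarrow> exec A s t' s'' \<Longrightarrow> t' = t \<and> s'' = s'"
proof (induction arbitrary: t' s'' rule: exec.induct)
  case Skip
  then show ?case by (auto elim: exec_SkipE)
next
  case NStore
  then show ?case by (auto elim: exec_NStoreE)
next
  case RStore
  then show ?case by (auto elim: exec_RStoreE)
next
  case Seq
  from Seq.prems show ?case by (rule exec_SeqE) (use Seq.IH in blast)
next
  case CondTrue
  from CondTrue.prems show ?case by (rule exec_CondE) (use CondTrue.hyps CondTrue.IH in blast)+
next
  case CondFalse
  from CondFalse.prems show ?case by (rule exec_CondE) (use CondFalse.hyps CondFalse.IH in blast)+
next
  case WhileFalse
  from WhileFalse.prems show ?case by (rule exec_WhileE) (use WhileFalse.hyps in auto)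
next
  case WhileTrue
  from WhileTrue.prems show ?case
    by (rule exec_WhileE) (use WhileTrue.hyps WhileTrue.IH in blast)+
qed


section \<open>Approximation algorithms\<close>

text \<open>
  An instance is presented to a program by an enumeration \<open>xs\<close> of the points; the program only
  sees indices into \<open>xs\<close>. All cells not mentioned here are initially \<open>0\<close>.
\<close>

definition encode ::
    "'a list \<Rightarrow> ('a \<Rightarrow> 'a \<Rightarrow> real) \<Rightarrow> ('a \<times> 'a) set \<Rightarrow> nat \<Rightarrow> store" where
  "encode xs d E k =
     \<lparr>nmem = (\<lambda>a i j.
        if a = ''n'' \<and> i = 0 \<and> j = 0 then length xs
        else if a = ''k'' \<and> i = 0 \<and> j = 0 then k
        else if a = ''E'' \<and> i < length xs \<and> j < length xs \<and> (xs ! i, xs ! j) \<in> E then 1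
        else 0),
      rmem = (\<lambda>a i j.
        if a = ''d'' \<and> i < length xs \<and> j < length xs then d (xs ! i) (xs ! j) else 0)\<rparr>"

definition out_clusters :: "'a list \<Rightarrow> store \<Rightarrow> nat \<Rightarrow> 'a set" where
  "out_clusters xs s i = {xs ! j |j. j < length xs \<and> nmem s ''cluster'' j 0 = i}"

definition out_centers :: "'a list \<Rightarrow> store \<Rightarrow> nat \<Rightarrow> 'a" where
  "out_centers xs s i = xs ! nmem s ''center'' i 0"

text \<open>
  Within \<open>T\<close> steps the program halts and, provided that the instance has a feasible solution at
  all, returns one of cost at most \<open>\<alpha>\<close> times the optimum. The bound on the center indices excludes
  reading \<open>xs\<close> out of range.
\<close>

definition approximates_center :: "com \<Rightarrow> real \<Rightarrow> nat \<Rightarrow>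
    'a list \<Rightarrow> ('a \<Rightarrow> 'a \<Rightarrow> real) \<Rightarrow> ('a \<times> 'a) set \<Rightarrow> nat \<Rightarrow> bool" where
  "approximates_center A \<alpha> T xs d E k \<longleftrightarrow>
     (\<exists>t s. exec A (encode xs d E k) t s \<and> t \<le> T \<and>
        ((\<exists>C c. connected_center_clustering (set xs) E k C c) \<longrightarrow>
           (\<forall>i<k. nmem s ''center'' i 0 < length xs) \<and>
           connected_center_clustering (set xs) E k (out_clusters xs s) (out_centers xs s) \<and>
           center_cost d k (out_clusters xs s) (out_centers xs s)
             \<le> \<alpha> * center_opt (set xs) d E k))"

definition approximates_diameter :: "com \<Rightarrow> real \<Rightarrow> nat \<Rightarrow>
    'a list \<Rightarrow> ('a \<Rightarrow> 'a \<Rightarrow> real) \<Rightarrow> ('a \<times> 'a) set \<Rightarrow> nat \<Rightarrow> bool" where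
  "approximates_diameter A \<alpha> T xs d E k \<longleftrightarrow>
     (\<exists>t s. exec A (encode xs d E k) t s \<and> t \<le> T \<and>
        ((\<exists>C. connected_clustering (set xs) E k C) \<longrightarrow>
           connected_clustering (set xs) E k (out_clusters xs s) \<and>
           diameter_cost d k (out_clusters xs s) \<le> \<alpha> * diameter_opt (set xs) d E k))"

end

(* Both problems are solved by one program that approximates the diameter; this loses a factor of 2
   for centers. For a guess D of the optimal diameter, points are labelled in phases. A phase scans
   the points w; if w is still unlabelled and farther than 4D from all points chosen before in the
   same phase, then w is chosen: each unlabelled point v within D of w becomes the root of a new
   cluster, and labels are then propagated along the edges inside the ball of radius 2D around w.

   If D is at least the optimal diameter, the optimal cluster of v lies in that ball and is connected,
   so it is completely labelled afterwards and produces no further root: there are at most k roots.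
   The balls of one phase are disjoint, so a phase increases the radius of a cluster by at most 4D.
   The chosen points are more than D apart, and every point that is unlabelled after c phases has at
   least c of them within 4D. Covering this ball three times by balls of half the radius bounds c by
   the cube of the doubling constant.

   Clusters can be split to reach exactly k: declare arbitrary further points to be roots and
   propagate labels again inside each old cluster. *)
theory Submission
  imports Defs
begin

section \<open>Loop programs\<close>

text \<open>The program never learns the doubling constant. It runs \<open>n\<close> phases for
  every guess, which label all points in any metric, because a point still unlabelled would have
  \<open>n\<close> chosen points besides itself. Packing enters only the analysis: it limits how
  many of these phases can enlarge a cluster.

  A guess is judged by its number of roots alone. Every result with at most \<open>k\<close> roots
  is usable, and no guess that admits a solution of that diameter is rejected. Since the optimal
  diameter is a distance between two points, trying all pairs and keeping the smallest accepted
  distance gives a value at most the optimum; it may well lie below it.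

  With K the doubling constant and N = K ^ 3, clusters have radius at most 4 * D * (N + 1), hence
  diameter at most 8 * D * (K ^ 3 + 1) \<le> 16 * D * K ^ 3.

  All loops run over the indices below \<open>n\<close>. A program then denotes a total function on
  stores, about which correctness can be proved without mentioning executions, and its running time
  is a polynomial computed from its syntax.\<close>

datatype prog =
    NAssign vname nexp nexp nexp
  | RAssign vname nexp nexp rexp
  | Then prog prog (infixr ";;" 60)
  | When bexp prog
  | For vname prog

primrec compile :: "prog \<Rightarrow> com" where
  "compile (NAssign a e f g) = NStore a e f g"
| "compile (RAssign a e f r) = RStore a e f r"
| "compile (p ;; q) = Seq (compile p) (compile q)"
| "compile (When b p) = Cond b (compile p) Skip"
| "compile (For i p) =
     Seq (NStore i (NConst 0) (NConst 0) (NConst 0))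
       (While (NLess (NLoad i (NConst 0) (NConst 0)) (NLoad ''n'' (NConst 0) (NConst 0)))
         (Seq (compile p)
           (NStore i (NConst 0) (NConst 0) (NAdd (NLoad i (NConst 0) (NConst 0)) (NConst 1)))))"

definition put :: "vname \<Rightarrow> nat \<Rightarrow> store \<Rightarrow> store" where
  "put i v s = s\<lparr>nmem := upd (nmem s) i 0 0 v\<rparr>"

text \<open>The number of rounds is fixed on entry, whereas the compiled loop rereads
  \<open>''n''\<close> and its counter in every test. \<open>wf_prog\<close> makes the two
  agree.\<close>

primrec run :: "prog \<Rightarrow> store \<Rightarrow> store" where
  "run (NAssign a e f g) s = s\<lparr>nmem := upd (nmem s) a (nval e s) (nval f s) (nval g s)\<rparr>"
| "run (RAssign a e f r) s = s\<lparr>rmem := upd (rmem s) a (nval e s) (nval f s) (rval r s)\<rparr>"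
| "run (p ;; q) s = run q (run p s)"
| "run (When b p) s = (if bval b s then run p s else s)"
| "run (For i p) s =
     ((\<lambda>t. put i (Suc (nmem t i 0 0)) (run p t)) ^^ nmem s ''n'' 0 0) (put i 0 s)"

primrec nwrites :: "prog \<Rightarrow> vname set" where
  "nwrites (NAssign a e f g) = {a}"
| "nwrites (RAssign a e f r) = {}"
| "nwrites (p ;; q) = nwrites p \<union> nwrites q"
| "nwrites (When b p) = nwrites p"
| "nwrites (For i p) = insert i (nwrites p)"

primrec rwrites :: "prog \<Rightarrow> vname set" where
  "rwrites (NAssign a e f g) = {}"
| "rwrites (RAssign a e f r) = {a}"
| "rwrites (p ;; q) = rwrites p \<union> rwrites q"
| "rwrites (When b p) = rwrites p"
| "rwrites (For i p) = rwrites p"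

text \<open>A loop body leaves the counter and \<open>''n''\<close> alone. The first part of a
  sequence also preserves \<open>''n''\<close>, so that the cost of the second part may be evaluated
  at the initial size.\<close>

primrec wf_prog :: "prog \<Rightarrow> bool" where
  "wf_prog (NAssign a e f g) \<longleftrightarrow> True"
| "wf_prog (RAssign a e f r) \<longleftrightarrow> True"
| "wf_prog (p ;; q) \<longleftrightarrow> wf_prog p \<and> wf_prog q \<and> ''n'' \<notin> nwrites p"
| "wf_prog (When b p) \<longleftrightarrow> wf_prog p"
| "wf_prog (For i p) \<longleftrightarrow> wf_prog p \<and> i \<notin> nwrites p \<and> i \<noteq> ''n'' \<and> ''n'' \<notin> nwrites p"

text \<open>In a conditional, \<open>[:2:]\<close> covers the test and the \<open>Skip\<close> of
  the other branch. In a loop it stands once for the initialisation and the failing last test, and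
  once per round for the test and the increment.\<close>

primrec cost :: "prog \<Rightarrow> nat poly" where
  "cost (NAssign a e f g) = 1"
| "cost (RAssign a e f r) = 1"
| "cost (p ;; q) = cost p + cost q"
| "cost (When b p) = cost p + [:2:]"
| "cost (For i p) = [:2:] + [:0, 1:] * (cost p + [:2:])"

lemma upd_apply:
  "upd m a i j v b x y = (if b = a \<and> x = i \<and> y = j then v else m b x y)"
  by (simp add: upd_def)

lemma upd_other [simp]: "b \<noteq> a \<Longrightarrow> upd m a i j v b = m b"
  by (simp add: upd_def)

lemma put_simps [simp]:
  "a \<noteq> i \<Longrightarrow> nmem (put i v s) a = nmem s a"
  "nmem (put i v s) i 0 0 = v"
  "rmem (put i v s) = rmem s"
  by (simp_all add: put_def upd_apply)

lemma run_frame: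
  "a \<notin> nwrites p \<Longrightarrow> nmem (run p s) a = nmem s a"
  "a \<notin> rwrites p \<Longrightarrow> rmem (run p s) a = rmem s a"
proof (induction p arbitrary: s)
  case (For i p)
  {
    case 1
    have "nmem (((\<lambda>t. put i (Suc (nmem t i 0 0)) (run p t)) ^^ m) (put i 0 s)) a = nmem s a" for m
      by (induction m) (use 1 For in auto)
    then show ?case by simp
  next
    case 2
    have "rmem (((\<lambda>t. put i (Suc (nmem t i 0 0)) (run p t)) ^^ m) (put i 0 s)) a = rmem s a" for m
      by (induction m) (use 2 For in auto)
    then show ?case by simp
  }
qed auto

text \<open>The frame conditions compare each intermediate store with the one before the loop, so an
  invariant only has to speak about what the body writes.\<close>

lemma For_rule:
  assumes wf: "wf_prog (For i p)"
    and n: "nmem s ''n'' 0 0 = n"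
    and base: "I 0 (put i 0 s)"
    and step: "\<And>j t. \<lbrakk>j < n; nmem t i 0 0 = j; \<And>a. a \<notin> insert i (nwrites p) \<Longrightarrow> nmem t a = nmem s a;
      \<And>a. a \<notin> rwrites p \<Longrightarrow> rmem t a = rmem s a; I j t\<rbrakk> \<Longrightarrow> I (Suc j) (put i (Suc j) (run p t))"
  shows "I n (run (For i p) s)"
proof -
  let ?f = "\<lambda>t. put i (Suc (nmem t i 0 0)) (run p t)"
  have "I m ((?f ^^ m) (put i 0 s)) \<and> nmem ((?f ^^ m) (put i 0 s)) i 0 0 = m
     \<and> (\<forall>a. a \<notin> insert i (nwrites p) \<longrightarrow> nmem ((?f ^^ m) (put i 0 s)) a = nmem s a)
     \<and> (\<forall>a. a \<notin> rwrites p \<longrightarrow> rmem ((?f ^^ m) (put i 0 s)) a = rmem s a)" if "m \<le> n" for m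
    using that
  proof (induction m)
    case 0
    then show ?case using base by simp
  next
    case (Suc m)
    then show ?case using step[of m "(?f ^^ m) (put i 0 s)"] run_frame by simp
  qed
  from this[of n] show ?thesis using n by simp
qed

lemma exec_compile:
  "wf_prog p \<Longrightarrow> \<exists>t. exec (compile p) s t (run p s) \<and> t \<le> poly (cost p) (nmem s ''n'' 0 0)"
proof (induction p arbitrary: s)
  case NAssign
  then show ?case using exec.NStore by fastforce
next
  case RAssign
  then show ?case using exec.RStore by fastforce
next
  case (Then p q)
  show ?case
  proof (cases "''n'' \<in> nwrites p")
    case True
    then show ?thesis using Then.prems by simp
  next
    case False
    obtain t where t: "exec (compile p) s t (run p s)" "t \<le> poly (cost p) (nmem s ''n'' 0 0)"
      using Then by fastforce
    obtain u where u: "exec (compile q) (run p s) u (run q (run p s))"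
      "u \<le> poly (cost q) (nmem (run p s) ''n'' 0 0)"
      using Then by fastforce
    have "exec (compile (p ;; q)) s (t + u) (run (p ;; q) s)"
      using exec.Seq[OF t(1) u(1)] by simp
    then show ?thesis using t u run_frame(1)[OF False] by fastforce
  qed
next
  case (When b p)
  show ?case
  proof (cases "bval b s")
    case True
    obtain t where t: "exec (compile p) s t (run p s)" "t \<le> poly (cost p) (nmem s ''n'' 0 0)"
      using When by fastforce
    then show ?thesis using exec.CondTrue[OF True t(1)] True by fastforce
  next
    case False
    show ?thesis using exec.CondFalse[OF False exec.Skip] False by fastforce
  qed
next
  case (For i p)
  let ?n = "nmem s ''n'' 0 0"
  let ?b = "NLess (NLoad i (NConst 0) (NConst 0)) (NLoad ''n'' (NConst 0) (NConst 0))"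
  let ?body = "Seq (compile p)
    (NStore i (NConst 0) (NConst 0) (NAdd (NLoad i (NConst 0) (NConst 0)) (NConst 1)))"
  let ?f = "\<lambda>t. put i (Suc (nmem t i 0 0)) (run p t)"
  let ?c = "poly (cost p) ?n"
  \<comment> \<open>Induction on the rounds still to come, for an arbitrary store, because
    \<open>WhileTrue\<close> unfolds the loop at its front.\<close>
  have loop: "\<exists>u. exec (While ?b ?body) t u ((?f ^^ m) t) \<and> u \<le> m * (?c + 2) + 1"
    if "nmem t ''n'' 0 0 = ?n" "nmem t i 0 0 + m = ?n" for m t
    using that
  proof (induction m arbitrary: t)
    case 0
    have "exec (While ?b ?body) t 1 t"
      by (rule exec.WhileFalse) (use 0 in simp)
    then show ?case by auto
  next
    case (Suc m)
    obtain u where u: "exec (compile p) t u (run p t)" "u \<le> ?c"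
      using For.IH[of t] For.prems Suc.prems by auto
    have i: "nmem (run p t) i = nmem t i"
      using For.prems by (simp add: run_frame)
    have body: "exec ?body t (u + 1) (?f t)"
      using exec.Seq[OF u(1) exec.NStore[of i "NConst 0" "NConst 0"
        "NAdd (NLoad i (NConst 0) (NConst 0)) (NConst 1)"]] i by (simp add: put_def)
    obtain w where w: "exec (While ?b ?body) (?f t) w ((?f ^^ m) (?f t))" "w \<le> m * (?c + 2) + 1"
      using Suc.IH[of "?f t"] Suc.prems For.prems run_frame(1)[of "''n''" p t] by auto
    have guard: "bval ?b t" using Suc.prems by simp
    have "exec (While ?b ?body) t (Suc (u + 1 + w)) ((?f ^^ Suc m) t)"
      using exec.WhileTrue[OF guard body w(1)] by (simp only: funpow_Suc_right o_apply)
    moreover have "Suc (u + 1 + w) \<le> Suc m * (?c + 2) + 1"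
      using u w by simp
    ultimately show ?case by blast
  qed
  obtain u where u: "exec (While ?b ?body) (put i 0 s) u ((?f ^^ ?n) (put i 0 s))"
    "u \<le> ?n * (?c + 2) + 1"
    using loop[of "put i 0 s" ?n] For.prems by auto
  have "exec (NStore i (NConst 0) (NConst 0) (NConst 0)) s 1 (put i 0 s)"
    using exec.NStore[of i "NConst 0" "NConst 0" "NConst 0" s] by (simp add: put_def)
  from exec.Seq[OF this u(1)]
  have "exec (compile (For i p)) s (1 + u) (run (For i p) s)" by simp
  moreover have "1 + u \<le> poly (cost (For i p)) ?n" using u(2) by simp
  ultimately show ?case by blast
qed

section \<open>Growing clusters by label propagation\<close>

text \<open>A labelling maps each labelled point to the successor of the root of its cluster and each
  unlabelled point to \<open>0\<close>.\<close>

definition roots :: "nat \<Rightarrow> (nat \<Rightarrow> nat) \<Rightarrow> nat set" where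
  "roots n l = {x. x < n \<and> l x = Suc x}"

text \<open>The value type is open because the relation serves both labellings and the partition of
  an optimal solution.\<close>

definition class_rel :: "nat \<Rightarrow> (nat \<Rightarrow> nat \<Rightarrow> bool) \<Rightarrow> (nat \<Rightarrow> 'b) \<Rightarrow> 'b \<Rightarrow> (nat \<times> nat) set" where
  "class_rel n e l c = {(u, v). u < n \<and> v < n \<and> e u v \<and> l u = c \<and> l v = c}"

text \<open>Paths lead from the root outward, the direction in which propagation extends them.
  Symmetry of the edges connects arbitrary pairs at the very end.\<close>

definition rooted :: "nat \<Rightarrow> (nat \<Rightarrow> nat \<Rightarrow> bool) \<Rightarrow> (nat \<Rightarrow> nat) \<Rightarrow> bool" where
  "rooted n e l \<longleftrightarrow> (\<forall>x<n. l x \<noteq> 0 \<longrightarrow> l x - 1 < n \<and> l (l x - 1) = l x \<and>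
     (l x - 1, x) \<in> (class_rel n e l (l x))\<^sup>*)"

text \<open>A single relabelling as a nondeterministic step, so that the order in which the loops
  visit pairs of points stays out of the proofs.\<close>

definition prop_step ::
    "nat \<Rightarrow> (nat \<Rightarrow> nat \<Rightarrow> bool) \<Rightarrow> (nat \<Rightarrow> nat) \<Rightarrow> (nat \<Rightarrow> nat) \<Rightarrow> bool" where
  "prop_step n A l l' \<longleftrightarrow>
     (\<exists>x<n. \<exists>y<n. A x y \<and> l x \<noteq> 0 \<and> l y = 0 \<and> l' = l(y := l x))"

text \<open>Old labels spread as well as that of the newest root: what matters for the number of
  roots is that a point is labelled, not by which cluster.\<close>

definition saturated :: "nat \<Rightarrow> (nat \<Rightarrow> nat \<Rightarrow> bool) \<Rightarrow> (nat \<Rightarrow> nat) \<Rightarrow> bool" where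
  "saturated n A l \<longleftrightarrow> (\<forall>x<n. \<forall>y<n. A x y \<and> l x \<noteq> 0 \<longrightarrow> l y \<noteq> 0)"

definition propagated ::
    "nat \<Rightarrow> (nat \<Rightarrow> nat \<Rightarrow> bool) \<Rightarrow> (nat \<Rightarrow> nat) \<Rightarrow> (nat \<Rightarrow> nat) \<Rightarrow> bool" where
  "propagated n A l l' \<longleftrightarrow> (prop_step n A)\<^sup>*\<^sup>* l l' \<and> saturated n A l'"

lemma finite_roots [simp]: "finite (roots n l)"
  by (simp add: roots_def)

lemma prop_step_mono: "prop_step n A l l' \<Longrightarrow> l x \<noteq> 0 \<Longrightarrow> l' x = l x"
  unfolding prop_step_def by fastforce

lemma prop_steps_mono: "(prop_step n A)\<^sup>*\<^sup>* l l' \<Longrightarrow> l x \<noteq> 0 \<Longrightarrow> l' x = l x"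
proof (induction rule: rtranclp_induct)
  case (step l1 l2)
  then show ?case using prop_step_mono[OF step.hyps(2), of x] by simp
qed simp

lemma prop_steps_weaken:
  assumes "(prop_step n A)\<^sup>*\<^sup>* l l'" "\<And>x y. \<lbrakk>x < n; y < n; A x y\<rbrakk> \<Longrightarrow> B x y"
  shows "(prop_step n B)\<^sup>*\<^sup>* l l'"
proof -
  have "prop_step n A \<le> prop_step n B"
    unfolding prop_step_def using assms(2) by (intro predicate2I) blast
  from rtranclp_mono[OF this, THEN predicate2D, OF assms(1)] show ?thesis .
qed

lemma class_rel_mono:
  assumes "\<And>x. x < n \<Longrightarrow> l x = c \<Longrightarrow> l' x = c'" "(u, v) \<in> (class_rel n e l c)\<^sup>*"
  shows "(u, v) \<in> (class_rel n e l' c')\<^sup>*"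
proof -
  have "class_rel n e l c \<subseteq> class_rel n e l' c'"
    unfolding class_rel_def using assms(1) by blast
  from subsetD[OF rtrancl_mono[OF this] assms(2)] show ?thesis .
qed

text \<open>The path to \<open>x\<close> is prolonged by one edge to \<open>y\<close>. The set of
  roots is stable because the root named by the label of \<open>x\<close> is itself labelled, hence
  different from \<open>y\<close>.\<close>

lemma rooted_prop_step:
  assumes "rooted n e l" "prop_step n e l l'"
  shows "rooted n e l' \<and> roots n l' = roots n l"
proof -
  obtain x y where xy: "x < n" "y < n" "e x y" "l x \<noteq> 0" "l y = 0" "l' = l(y := l x)"
    using assms(2) by (auto simp: prop_step_def)
  have r: "l x - 1 < n" "l (l x - 1) = l x" "(l x - 1, x) \<in> (class_rel n e l (l x))\<^sup>*"
    using assms(1) xy by (auto simp: rooted_def)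
  have mono: "(u, v) \<in> (class_rel n e l' c)\<^sup>*"
    if "c \<noteq> 0" "(u, v) \<in> (class_rel n e l c)\<^sup>*" for u v c
    by (rule class_rel_mono[OF _ that(2)]) (use that(1) xy in auto)
  have "l' z - 1 < n \<and> l' (l' z - 1) = l' z \<and> (l' z - 1, z) \<in> (class_rel n e l' (l' z))\<^sup>*"
    if z: "z < n" "l' z \<noteq> 0" for z
  proof (cases "z = y")
    case True
    have "(x, y) \<in> class_rel n e l' (l x)"
      using xy by (auto simp: class_rel_def)
    then have "(l x - 1, y) \<in> (class_rel n e l' (l x))\<^sup>*"
      using mono[OF xy(4) r(3)] by (rule rtrancl.rtrancl_into_rtrancl[rotated])
    moreover have "l x - 1 \<noteq> y" using r(2) xy by auto
    ultimately show ?thesis using True r xy by simp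
  next
    case False
    then have lz: "l' z = l z" "l z \<noteq> 0" using xy z by auto
    then have rz: "l z - 1 < n" "l (l z - 1) = l z" "(l z - 1, z) \<in> (class_rel n e l (l z))\<^sup>*"
      using assms(1) z by (auto simp: rooted_def)
    then have "l z - 1 \<noteq> y" using xy lz by auto
    then show ?thesis using lz rz mono[OF lz(2) rz(3)] xy by simp
  qed
  moreover have "l x \<noteq> Suc y" using r xy by auto
  then have "roots n l' = roots n l"
    using xy by (auto simp: roots_def)
  ultimately show ?thesis by (auto simp: rooted_def)
qed

lemma rooted_prop_steps:
  assumes "(prop_step n e)\<^sup>*\<^sup>* l l'" "rooted n e l"
  shows "rooted n e l' \<and> roots n l' = roots n l"
  using assms
proof (induction rule: rtranclp_induct)
  case (step l1 l2)
  then show ?case using rooted_prop_step[of n e l1 l2] by simp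
qed simp

lemma rooted_new_root:
  assumes "rooted n e l" "v < n" "l v = 0"
  shows "rooted n e (l(v := Suc v)) \<and> roots n (l(v := Suc v)) = insert v (roots n l)"
proof -
  let ?l = "l(v := Suc v)"
  have "?l z - 1 < n \<and> ?l (?l z - 1) = ?l z \<and> (?l z - 1, z) \<in> (class_rel n e ?l (?l z))\<^sup>*"
    if z: "z < n" "?l z \<noteq> 0" for z
  proof (cases "z = v")
    case False
    then have rz: "l z - 1 < n" "l (l z - 1) = l z" "(l z - 1, z) \<in> (class_rel n e l (l z))\<^sup>*"
      using assms(1) z by (auto simp: rooted_def)
    then have "l z - 1 \<noteq> v" using assms False z by auto
    moreover have "(l z - 1, z) \<in> (class_rel n e ?l (l z))\<^sup>*"
      by (rule class_rel_mono[OF _ rz(3)]) (use assms False z in auto)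
    ultimately show ?thesis using rz False by simp
  qed (use assms in auto)
  then show ?thesis using assms by (auto simp: rooted_def roots_def)
qed

text \<open>The labelled points are closed under \<open>A\<close>, so being labelled travels along
  any path whose edges all lie in \<open>A\<close>. This is used for optimal clusters inside a ball
  and for old clusters during splitting.\<close>

lemma saturated_class:
  assumes "saturated n A l" "(u, v) \<in> (class_rel n e o' c)\<^sup>*" "l u \<noteq> 0"
    and "\<And>x y. \<lbrakk>x < n; y < n; e x y; o' x = c; o' y = c\<rbrakk> \<Longrightarrow> A x y"
  shows "l v \<noteq> 0"
  using assms(2,3)
proof (induction rule: rtrancl_induct)
  case (step y z)
  then have "y < n" "z < n" "A y z" using assms(4) by (auto simp: class_rel_def)
  then show ?case using assms(1) step.IH step.prems unfolding saturated_def by blast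
qed

section \<open>Every root claims an optimal cluster of its own\<close>

locale index_metric =
  fixes n :: nat and dd :: "nat \<Rightarrow> nat \<Rightarrow> real" and e :: "nat \<Rightarrow> nat \<Rightarrow> bool"
  assumes dd_refl: "x < n \<Longrightarrow> dd x x = 0"
    and dd_sym: "x < n \<Longrightarrow> y < n \<Longrightarrow> dd x y = dd y x"
    and dd_triangle: "x < n \<Longrightarrow> y < n \<Longrightarrow> z < n \<Longrightarrow> dd x z \<le> dd x y + dd y z"
begin

lemma dd_nonneg: "x < n \<Longrightarrow> y < n \<Longrightarrow> 0 \<le> dd x y"
  using dd_triangle[of x y x] dd_refl[of x] dd_sym[of x y] by simp

text \<open>The reach \<open>2 * D\<close> has two parts: at most \<open>D\<close> from
  \<open>w\<close> to a new root, and at most \<open>D\<close> from there through the optimal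
  cluster of that root.\<close>

definition near :: "real \<Rightarrow> nat \<Rightarrow> nat \<Rightarrow> nat \<Rightarrow> bool" where
  "near D w x y \<longleftrightarrow> e x y \<and> dd x w \<le> 2 * D \<and> dd y w \<le> 2 * D"

definition root_step :: "real \<Rightarrow> nat \<Rightarrow> (nat \<Rightarrow> nat) \<Rightarrow> (nat \<Rightarrow> nat) \<Rightarrow> bool" where
  "root_step D w l l' \<longleftrightarrow>
     (\<exists>v<n. dd v w \<le> D \<and> l v = 0 \<and> propagated n (near D w) (l(v := Suc v)) l')"

text \<open>The point \<open>w\<close> is arbitrary here: the bound on the number of roots holds for
  every choice of centres, and only the radius depends on choosing them well.\<close>

definition grow_step :: "real \<Rightarrow> (nat \<Rightarrow> nat) \<Rightarrow> (nat \<Rightarrow> nat) \<Rightarrow> bool" where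
  "grow_step D l l' \<longleftrightarrow> (\<exists>w<n. root_step D w l l')"

lemma root_step_mono:
  assumes "root_step D w l l'" "l x \<noteq> 0"
  shows "l' x = l x"
proof -
  obtain v where v: "l v = 0" "propagated n (near D w) (l(v := Suc v)) l'"
    using assms(1) by (auto simp: root_step_def)
  moreover have "x \<noteq> v" using assms v by auto
  ultimately show ?thesis
    using prop_steps_mono[of n "near D w" "l(v := Suc v)" l' x] assms(2)
    by (simp add: propagated_def)
qed

lemma root_steps_mono:
  "(root_step D w)\<^sup>*\<^sup>* l l' \<Longrightarrow> l x \<noteq> 0 \<Longrightarrow> l' x = l x"
proof (induction rule: rtranclp_induct)
  case (step l1 l2)
  then show ?case using root_step_mono[OF step.hyps(2), of x] by simp
qed simp

lemma rooted_root_step: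
  assumes "root_step D w l l'" "rooted n e l"
  shows "rooted n e l' \<and> (\<exists>v<n. dd v w \<le> D \<and> l v = 0 \<and> roots n l' = insert v (roots n l) \<and>
    l' v = Suc v \<and> saturated n (near D w) l')"
proof -
  obtain v where v: "v < n" "dd v w \<le> D" "l v = 0" "propagated n (near D w) (l(v := Suc v)) l'"
    using assms(1) by (auto simp: root_step_def)
  then have "(prop_step n e)\<^sup>*\<^sup>* (l(v := Suc v)) l'"
    by (auto simp: propagated_def near_def elim: prop_steps_weaken)
  from rooted_prop_steps[OF this] rooted_new_root[OF assms(2) v(1,3)] prop_steps_mono[OF this, of v]
  show ?thesis using v by (auto simp: propagated_def)
qed

definition partition_diam :: "real \<Rightarrow> (nat \<Rightarrow> 'b) \<Rightarrow> bool" where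
  "partition_diam D p \<longleftrightarrow> (\<forall>x<n. \<forall>y<n. p x = p y \<longrightarrow>
     dd x y \<le> D \<and> (x, y) \<in> (class_rel n e p (p x))\<^sup>*)"

text \<open>The first conjunct bounds the roots by the number of optimal clusters. The second makes
  it inductive, because new roots are taken among unlabelled points.\<close>

definition swallowed :: "(nat \<Rightarrow> 'b) \<Rightarrow> (nat \<Rightarrow> nat) \<Rightarrow> bool" where
  "swallowed p l \<longleftrightarrow> inj_on p (roots n l) \<and>
     (\<forall>r\<in>roots n l. \<forall>x<n. p x = p r \<longrightarrow> l x \<noteq> 0)"

text \<open>The optimal cluster of the new root \<open>v\<close> stays within \<open>D\<close> of
  \<open>v\<close>, hence within \<open>2 * D\<close> of \<open>w\<close>. It is connected, so
  saturation inside the ball labels all of it.\<close>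

lemma swallowed_grow_step:
  assumes "partition_diam D p" "rooted n e l" "swallowed p l" "grow_step D l l'"
  shows "swallowed p l'"
proof -
  obtain w where w: "w < n" "root_step D w l l'"
    using assms(4) by (auto simp: grow_step_def)
  obtain v where v: "v < n" "dd v w \<le> D" "l v = 0" "roots n l' = insert v (roots n l)"
    "l' v = Suc v" "saturated n (near D w) l'"
    using rooted_root_step[OF w(2) assms(2)] by auto
  have "l' x \<noteq> 0" if x: "x < n" "p x = p v" for x
  proof (rule saturated_class[OF v(6)])
    show "(v, x) \<in> (class_rel n e p (p v))\<^sup>*"
      using assms(1) v x unfolding partition_diam_def by metis
    fix y z assume yz: "y < n" "z < n" "e y z" "p y = p v" "p z = p v"
    then have "dd y v \<le> D" "dd z v \<le> D"
      using assms(1) v unfolding partition_diam_def by auto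
    then show "near D w y z"
      using dd_triangle[of y v w] dd_triangle[of z v w] v w yz by (auto simp: near_def)
  qed (use v in simp)
  moreover have "l' x \<noteq> 0" if "r \<in> roots n l" "x < n" "p x = p r" for x r
    using assms(3) that root_step_mono[OF w(2), of x] by (auto simp: swallowed_def)
  \<comment> \<open>If an earlier root shared the optimal cluster of \<open>v\<close>, then
    \<open>v\<close> would already have been labelled.\<close>
  moreover have "p v \<noteq> p r" if "r \<in> roots n l" for r
    using assms(3) that v(1,3) unfolding swallowed_def by metis
  ultimately show ?thesis
    using assms(3) v(4) by (auto simp: swallowed_def)
qed

lemma grow_steps:
  assumes "(grow_step D)\<^sup>*\<^sup>* (\<lambda>_. 0) l"
  shows "rooted n e l \<and> (\<forall>p :: nat \<Rightarrow> 'b. partition_diam D p \<longrightarrow> swallowed p l)"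
  using assms
proof (induction rule: rtranclp_induct)
  case base
  then show ?case by (auto simp: rooted_def swallowed_def roots_def)
next
  case (step l l')
  then have "rooted n e l'" using rooted_root_step by (auto simp: grow_step_def)
  then show ?case using step swallowed_grow_step by blast
qed

lemma card_roots_le:
  assumes "(grow_step D)\<^sup>*\<^sup>* (\<lambda>_. 0) l" "partition_diam D p" "p ` {..<n} \<subseteq> {..<k::nat}"
  shows "card (roots n l) \<le> k"
proof -
  have "inj_on p (roots n l)" using grow_steps[OF assms(1)] assms(2) by (auto simp: swallowed_def)
  moreover have "p ` roots n l \<subseteq> {..<k}" using assms(3) by (auto simp: roots_def)
  ultimately show ?thesis using card_inj_on_le[of p "roots n l" "{..<k}"] by simp
qed

end

section \<open>Nets, packing, and the growth of the radius over the phases\<close>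

context index_metric
begin

definition separated :: "real \<Rightarrow> nat set \<Rightarrow> bool" where
  "separated D S \<longleftrightarrow> S \<subseteq> {..<n} \<and> (\<forall>s\<in>S. \<forall>t\<in>S. s \<noteq> t \<longrightarrow> D < dd s t)"

text \<open>The one consequence of the doubling property that the analysis of phases relies on. The
  guess \<open>D = 0\<close> is included, since a pair of equal points is also tried.\<close>

definition packing_le :: "nat \<Rightarrow> bool" where
  "packing_le N \<longleftrightarrow> (\<forall>D\<ge>0. \<forall>u<n. \<forall>S. separated D S \<and> (\<forall>s\<in>S. dd u s \<le> 4 * D) \<longrightarrow> card S \<le> N)"

text \<open>The labelled \<open>D\<close>-balls are the reason for the separation: a point that is
  still unlabelled, and may be chosen next, is farther than \<open>D\<close> from all earlier
  choices.\<close>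

definition net :: "real \<Rightarrow> nat set \<Rightarrow> (nat \<Rightarrow> nat) \<Rightarrow> bool" where
  "net D S l \<longleftrightarrow> separated D S \<and> (\<forall>s\<in>S. \<forall>v<n. dd v s \<le> D \<longrightarrow> l v \<noteq> 0)"

definition radius_le :: "real \<Rightarrow> (nat \<Rightarrow> nat) \<Rightarrow> bool" where
  "radius_le B l \<longleftrightarrow> (\<forall>x<n. l x \<noteq> 0 \<longrightarrow> dd x (l x - 1) \<le> B)"

text \<open>All points are labelled after \<open>Suc N\<close> phases, so the minimum stops the growth there.\<close>

definition phase_bound :: "real \<Rightarrow> nat \<Rightarrow> nat \<Rightarrow> real" where
  "phase_bound D N c = 4 * D * real (min c (Suc N))"

text \<open>\<open>S\<close> collects the choices of all \<open>c\<close> phases so far. It exists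
  in the proof only; the program merely tracks the neighbourhoods of the current phase.\<close>

definition guess_inv :: "real \<Rightarrow> nat \<Rightarrow> nat \<Rightarrow> (nat \<Rightarrow> nat) \<Rightarrow> bool" where
  "guess_inv D N c l \<longleftrightarrow> (grow_step D)\<^sup>*\<^sup>* (\<lambda>_. 0) l \<and> radius_le (phase_bound D N c) l \<and>
     (\<exists>S. net D S l \<and> (\<forall>u<n. l u = 0 \<longrightarrow> c \<le> card {s \<in> S. dd u s \<le> 4 * D}))"

text \<open>\<open>B\<close> is the radius before the phase, \<open>S\<close> and \<open>W\<close>
  hold the choices made before and during it. Growth beyond \<open>B\<close> is confined to the
  balls around \<open>W\<close>, so a ball disjoint from these starts from radius \<open>B\<close>
  again.\<close>

definition phase_inv ::
    "real \<Rightarrow> real \<Rightarrow> nat set \<Rightarrow> nat set \<Rightarrow> (nat \<Rightarrow> nat) \<Rightarrow> bool" where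
  "phase_inv D B S W l \<longleftrightarrow> net D (S \<union> W) l \<and> S \<inter> W = {} \<and> radius_le (B + 4 * D) l \<and>
     (\<forall>x<n. l x \<noteq> 0 \<and> B < dd x (l x - 1) \<longrightarrow> (\<exists>w\<in>W. dd x w \<le> 2 * D))"

text \<open>While \<open>w\<close> is processed, every label inside the ball around \<open>w\<close> is also carried there by a point
  within distance \<open>B\<close> of its root. Hence labels grow by one ball diameter only.\<close>

definition anchored :: "real \<Rightarrow> real \<Rightarrow> nat \<Rightarrow> (nat \<Rightarrow> nat) \<Rightarrow> bool" where
  "anchored D B w l \<longleftrightarrow> (\<forall>x<n. dd x w \<le> 2 * D \<and> l x \<noteq> 0 \<longrightarrow>
     (\<exists>z<n. dd z w \<le> 2 * D \<and> l z = l x \<and> dd z (l x - 1) \<le> B))"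

lemma anchored_prop_step:
  assumes "anchored D B w l" "prop_step n (near D w) l l'"
  shows "anchored D B w l' \<and> (\<forall>x. 2 * D < dd x w \<longrightarrow> l' x = l x)"
proof -
  obtain x y where xy: "x < n" "y < n" "near D w x y" "l x \<noteq> 0" "l y = 0" "l' = l(y := l x)"
    using assms(2) by (auto simp: prop_step_def)
  have "\<exists>z<n. dd z w \<le> 2 * D \<and> l' z = l' u \<and> dd z (l' u - 1) \<le> B"
    if u: "u < n" "dd u w \<le> 2 * D" "l' u \<noteq> 0" for u
  proof -
    \<comment> \<open>The freshly labelled \<open>y\<close> copied its label from \<open>x\<close>,
      a point of the same ball, and inherits the anchor of \<open>x\<close>.\<close>
    define u' where "u' = (if u = y then x else u)"
    have u': "u' < n" "dd u' w \<le> 2 * D" "l u' = l' u" "l u' \<noteq> 0"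
      using u xy by (auto simp: u'_def near_def)
    then obtain z where "z < n" "dd z w \<le> 2 * D" "l z = l u'" "dd z (l u' - 1) \<le> B"
      using assms(1) unfolding anchored_def by blast
    moreover from this have "z \<noteq> y" using u' xy by auto
    ultimately have "z < n \<and> dd z w \<le> 2 * D \<and> l' z = l' u \<and> dd z (l' u - 1) \<le> B"
      using u'(3) xy(6) by simp
    then show ?thesis ..
  qed
  then have "anchored D B w l'" by (simp add: anchored_def)
  moreover have "l' u = l u" if "2 * D < dd u w" for u
    using that xy(3,6) by (auto simp: near_def)
  ultimately show ?thesis by blast
qed

lemma anchored_root_step:
  assumes "anchored D B w l" "root_step D w l l'" "0 \<le> B" "w < n"
  shows "anchored D B w l' \<and> (\<forall>x. 2 * D < dd x w \<longrightarrow> l' x = l x)"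
proof -
  obtain v where v: "v < n" "dd v w \<le> D" "l v = 0" "(prop_step n (near D w))\<^sup>*\<^sup>* (l(v := Suc v)) l'"
    using assms(2) by (auto simp: root_step_def propagated_def)
  have vw: "dd v w \<le> 2 * D" using v assms(4) dd_nonneg[of v w] by linarith
  have "anchored D B w (l(v := Suc v))"
    unfolding anchored_def
  proof (intro allI impI)
    fix x assume x: "x < n" "dd x w \<le> 2 * D \<and> (l(v := Suc v)) x \<noteq> 0"
    show "\<exists>z<n. dd z w \<le> 2 * D \<and> (l(v := Suc v)) z = (l(v := Suc v)) x \<and>
      dd z ((l(v := Suc v)) x - 1) \<le> B"
    proof (cases "x = v")
      case True
      \<comment> \<open>A new root is its own anchor, at distance 0.\<close>
      then show ?thesis using v vw assms(3) dd_refl[of v] by (intro exI[of _ v]) auto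
    next
      case False
      then obtain z where "z < n" "dd z w \<le> 2 * D" "l z = l x" "dd z (l x - 1) \<le> B"
        using assms(1) x unfolding anchored_def by auto
      moreover from this have "z \<noteq> v" using v x False by auto
      ultimately show ?thesis using False by auto
    qed
  qed
  with v(4) have "anchored D B w l' \<and> (\<forall>x. 2 * D < dd x w \<longrightarrow> l' x = (l(v := Suc v)) x)"
  proof (induction rule: rtranclp_induct)
    case (step l1 l2)
    then show ?case using anchored_prop_step[of D B w l1 l2] by auto
  qed auto
  then show ?thesis using vw by auto
qed

lemma anchored_root_steps:
  assumes "(root_step D w)\<^sup>*\<^sup>* l l'" "anchored D B w l" "0 \<le> B" "w < n"
  shows "anchored D B w l' \<and> (\<forall>x. 2 * D < dd x w \<longrightarrow> l' x = l x)"
  using assms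
proof (induction rule: rtranclp_induct)
  case (step l1 l2)
  then show ?case using anchored_root_step[of D B w l1 l2] by auto
qed auto

text \<open>Before \<open>w\<close> is processed, labels in its ball have radius at most
  \<open>B\<close>: a point with a larger one lies within \<open>2 * D\<close> of some
  \<open>w'\<close> in \<open>W\<close>, which would put \<open>w'\<close> within
  \<open>4 * D\<close> of \<open>w\<close>. A newly labelled \<open>x\<close> then reaches its root
  via \<open>w\<close> and an anchor, at a length of at most
  \<open>2 * D + 2 * D + B\<close>.\<close>

lemma phase_inv_step:
  assumes inv: "phase_inv D B S W l" and "0 \<le> B" "0 \<le> D" "rooted n e l'"
    and w: "w < n" "l w = 0" "\<And>w'. w' \<in> W \<Longrightarrow> 4 * D < dd w w'"
    and steps: "(root_step D w)\<^sup>*\<^sup>* l l'" and all: "\<And>v. v < n \<Longrightarrow> dd v w \<le> D \<Longrightarrow> l' v \<noteq> 0"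
  shows "phase_inv D B S (insert w W) l'"
proof -
  have net: "net D (S \<union> W) l" and SW: "S \<inter> W = {}" and rad: "radius_le (B + 4 * D) l"
    and far: "\<And>x. x < n \<Longrightarrow> l x \<noteq> 0 \<Longrightarrow> B < dd x (l x - 1) \<Longrightarrow> \<exists>w\<in>W. dd x w \<le> 2 * D"
    using inv by (auto simp: phase_inv_def)
  have Wn: "S \<union> W \<subseteq> {..<n}" using net by (auto simp: net_def separated_def)
  have mono: "l x \<noteq> 0 \<Longrightarrow> l' x = l x" for x using root_steps_mono[OF steps] .
  \<comment> \<open>The \<open>D\<close>-balls around all earlier choices are labelled, whereas
    \<open>w\<close> is not.\<close>
  have wS: "D < dd w s" if "s \<in> S \<union> W" for s
    using net that w unfolding net_def by force
  have "anchored D B w l"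
    unfolding anchored_def
  proof (intro allI impI)
    fix x assume x: "x < n" "dd x w \<le> 2 * D \<and> l x \<noteq> 0"
    have "dd x (l x - 1) \<le> B"
    proof (rule ccontr)
      assume "\<not> ?thesis"
      then obtain w' where w': "w' \<in> W" "dd x w' \<le> 2 * D" using far[of x] x by auto
      then show False
        using dd_triangle[of w x w'] dd_sym[of x w] w(1) w(3)[of w'] x Wn by force
    qed
    then show "\<exists>z<n. dd z w \<le> 2 * D \<and> l z = l x \<and> dd z (l x - 1) \<le> B" using x by blast
  qed
  from anchored_root_steps[OF steps this \<open>0 \<le> B\<close> w(1)]
  have anch: "anchored D B w l'" and same: "\<And>x. 2 * D < dd x w \<Longrightarrow> l' x = l x" by auto
  have new: "dd x (l' x - 1) \<le> B + 4 * D" "dd x w \<le> 2 * D" if x: "x < n" "l' x \<noteq> 0" "l x = 0" for x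
  proof -
    show xw: "dd x w \<le> 2 * D" using same[of x] x by force
    obtain z where z: "z < n" "dd z w \<le> 2 * D" "dd z (l' x - 1) \<le> B"
      using anch x xw unfolding anchored_def by blast
    moreover have "l' x - 1 < n" using assms(4) x by (auto simp: rooted_def)
    ultimately show "dd x (l' x - 1) \<le> B + 4 * D"
      using dd_triangle[of x w "l' x - 1"] dd_triangle[of w z "l' x - 1"] dd_sym[of z w] w(1) x xw
      by fastforce
  qed
  have "net D (S \<union> insert w W) l'"
  proof -
    have "separated D (S \<union> insert w W)"
      unfolding separated_def
    proof (intro conjI ballI impI)
      fix s t assume st: "s \<in> S \<union> insert w W" "t \<in> S \<union> insert w W" "s \<noteq> t"
      then consider "s = w" "t \<in> S \<union> W" | "t = w" "s \<in> S \<union> W" | "s \<in> S \<union> W" "t \<in> S \<union> W"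
        by blast
      then show "D < dd s t"
      proof cases
        case 2
        then have "dd s t = dd w s" using dd_sym w(1) Wn by blast
        then show ?thesis using wS 2 by simp
      next
        case 3
        then show ?thesis using net st(3) unfolding net_def separated_def by blast
      qed (use wS in simp)
    qed (use w(1) Wn in auto)
    moreover have "l' v \<noteq> 0" if "s \<in> S \<union> W" "v < n" "dd v s \<le> D" for s v
      using net that mono[of v] unfolding net_def by force
    ultimately show ?thesis using all unfolding net_def by blast
  qed
  moreover have "w \<notin> S" using wS[of w] dd_refl[OF w(1)] \<open>0 \<le> D\<close> by auto
  moreover have "radius_le (B + 4 * D) l'"
    unfolding radius_le_def
  proof (intro allI impI)
    fix x assume "x < n" "l' x \<noteq> 0"
    then show "dd x (l' x - 1) \<le> B + 4 * D"
      using rad mono[of x] new(1)[of x] by (cases "l x = 0") (simp_all add: radius_le_def)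
  qed
  moreover have "\<exists>w'\<in>insert w W. dd x w' \<le> 2 * D" if "x < n" "l' x \<noteq> 0" "B < dd x (l' x - 1)" for x
  proof (cases "l x = 0")
    case False
    then show ?thesis using far[of x] mono[of x] that by fastforce
  qed (use new(2)[of x] that in blast)
  ultimately show ?thesis using SW unfolding phase_inv_def by blast
qed

text \<open>\<open>l\<^sub>0\<close> is the labelling at the start of the phase and the points below
  \<open>j\<close> have been scanned. The clause \<open>l = l\<^sub>0\<close> for a complete
  \<open>l\<^sub>0\<close> keeps idle phases from increasing the radius bound.\<close>

definition phase_state ::
    "real \<Rightarrow> nat \<Rightarrow> nat \<Rightarrow> (nat \<Rightarrow> nat) \<Rightarrow> nat \<Rightarrow> nat set \<Rightarrow> (nat \<Rightarrow> nat) \<Rightarrow> bool" where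
  "phase_state D N c l\<^sub>0 j W l \<longleftrightarrow> W \<subseteq> {..<n} \<and> (grow_step D)\<^sup>*\<^sup>* (\<lambda>_. 0) l \<and>
     (\<forall>x. l\<^sub>0 x \<noteq> 0 \<longrightarrow> l x \<noteq> 0) \<and> ((\<forall>x<n. l\<^sub>0 x \<noteq> 0) \<longrightarrow> l = l\<^sub>0) \<and>
     (\<forall>u<j. l u = 0 \<longrightarrow> (\<exists>w\<in>W. dd u w \<le> 4 * D)) \<and>
     (\<exists>S. phase_inv D (phase_bound D N c) S W l \<and>
       (\<forall>u<n. l\<^sub>0 u = 0 \<longrightarrow> c \<le> card {s \<in> S. dd u s \<le> 4 * D}))"

lemma phase_state_start:
  assumes "guess_inv D N c l" "0 \<le> D"
  shows "phase_state D N c l 0 {} l"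
proof -
  obtain S where "net D S l" "\<forall>u<n. l u = 0 \<longrightarrow> c \<le> card {s \<in> S. dd u s \<le> 4 * D}"
    using assms(1) by (auto simp: guess_inv_def)
  moreover from this have "phase_inv D (phase_bound D N c) S {} l"
    using assms by (force simp: guess_inv_def phase_inv_def radius_le_def)
  ultimately show ?thesis using assms by (auto simp: phase_state_def guess_inv_def)
qed

lemma phase_state_skip:
  assumes "phase_state D N c l\<^sub>0 j W l" "l j \<noteq> 0 \<or> (\<exists>w\<in>W. dd j w \<le> 4 * D)"
  shows "phase_state D N c l\<^sub>0 (Suc j) W l"
  using assms unfolding phase_state_def less_Suc_eq by blast

lemma phase_state_process:
  assumes st: "phase_state D N c l\<^sub>0 w W l" and "0 \<le> D" "w < n" "l w = 0"
    and blk: "\<not> (\<exists>w'\<in>W. dd w w' \<le> 4 * D)"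
    and steps: "(root_step D w)\<^sup>*\<^sup>* l l'" and all: "\<And>v. v < n \<Longrightarrow> dd v w \<le> D \<Longrightarrow> l' v \<noteq> 0"
  shows "phase_state D N c l\<^sub>0 (Suc w) (insert w W) l'"
proof -
  have "root_step D w \<le> grow_step D" using \<open>w < n\<close> by (auto simp: grow_step_def)
  from rtranclp_mono[OF this, THEN predicate2D, OF steps] have "(grow_step D)\<^sup>*\<^sup>* l l'" .
  moreover have "(grow_step D)\<^sup>*\<^sup>* (\<lambda>_. 0) l" using st unfolding phase_state_def by blast
  ultimately have grow: "(grow_step D)\<^sup>*\<^sup>* (\<lambda>_. 0) l'" by simp
  have mono: "l x \<noteq> 0 \<Longrightarrow> l' x \<noteq> 0" for x using root_steps_mono[OF steps] by simp
  obtain S where S: "phase_inv D (phase_bound D N c) S W l"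
    "\<forall>u<n. l\<^sub>0 u = 0 \<longrightarrow> c \<le> card {s \<in> S. dd u s \<le> 4 * D}"
    using st unfolding phase_state_def by blast
  have "phase_inv D (phase_bound D N c) S (insert w W) l'"
    by (rule phase_inv_step[OF S(1)])
      (use assms grow_steps[OF grow] in \<open>auto simp: phase_bound_def not_le\<close>)
  \<comment> \<open>Labels are never removed, so the unlabelled \<open>w\<close> was unlabelled at
    the start as well and this phase is not idle.\<close>
  moreover have "\<not> (\<forall>x<n. l\<^sub>0 x \<noteq> 0)" using st assms(3,4) unfolding phase_state_def by blast
  moreover have "dd w w \<le> 4 * D" using dd_refl[OF assms(3)] \<open>0 \<le> D\<close> by simp
  ultimately show ?thesis
    using st S(2) grow mono assms(3) unfolding phase_state_def less_Suc_eq
    by (intro conjI) blast+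
qed

text \<open>A point left unlabelled is blocked by a choice in \<open>W\<close>, and \<open>W\<close>
  is disjoint from \<open>S\<close>, so its count of nearby choices rises. For the radius, a point
  unlabelled at the start has \<open>c\<close> separated choices nearby; packing gives
  \<open>c \<le> N\<close>, and below that threshold the minimum in \<open>phase_bound\<close> still
  grows by one.\<close>

lemma phase_state_end:
  assumes st: "phase_state D N c l\<^sub>0 n W l" and l\<^sub>0: "guess_inv D N c l\<^sub>0"
    and pack: "packing_le N" and "0 \<le> D"
  shows "guess_inv D N (Suc c) l"
proof -
  have grow: "(grow_step D)\<^sup>*\<^sup>* (\<lambda>_. 0) l" using st unfolding phase_state_def by blast
  obtain S where S: "phase_inv D (phase_bound D N c) S W l"
    "\<And>u. u < n \<Longrightarrow> l\<^sub>0 u = 0 \<Longrightarrow> c \<le> card {s \<in> S. dd u s \<le> 4 * D}"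
    using st unfolding phase_state_def by blast
  have net: "net D (S \<union> W) l" "S \<inter> W = {}" using S(1) by (auto simp: phase_inv_def)
  then have fin: "finite (S \<union> W)"
    by (meson finite_lessThan finite_subset net_def separated_def)
  have "Suc c \<le> card {s \<in> S \<union> W. dd u s \<le> 4 * D}" if u: "u < n" "l u = 0" for u
  proof -
    have "l\<^sub>0 u = 0" using st u unfolding phase_state_def by blast
    then have "c \<le> card {s \<in> S. dd u s \<le> 4 * D}" using S(2) u by auto
    moreover obtain w where "w \<in> W" "dd u w \<le> 4 * D" using st u unfolding phase_state_def by blast
    moreover from this have "{s \<in> S. dd u s \<le> 4 * D} \<subset> {s \<in> S \<union> W. dd u s \<le> 4 * D}"
      using net by auto
    then have "card {s \<in> S. dd u s \<le> 4 * D} < card {s \<in> S \<union> W. dd u s \<le> 4 * D}"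
      using fin by (intro psubset_card_mono) auto
    ultimately show ?thesis by simp
  qed
  moreover have "radius_le (phase_bound D N (Suc c)) l"
  proof (cases "\<forall>x<n. l\<^sub>0 x \<noteq> 0")
    case True
    have "phase_bound D N c \<le> phase_bound D N (Suc c)"
      unfolding phase_bound_def using \<open>0 \<le> D\<close> by (intro mult_left_mono) auto
    then show ?thesis
      using True st l\<^sub>0 unfolding phase_state_def guess_inv_def radius_le_def
      by (metis order_trans)
  next
    case False
    then obtain u where u: "u < n" "l\<^sub>0 u = 0" by auto
    have "separated D {s \<in> S. dd u s \<le> 4 * D}"
      using net unfolding net_def separated_def by auto
    then have "card {s \<in> S. dd u s \<le> 4 * D} \<le> N"
      using pack u \<open>0 \<le> D\<close> unfolding packing_le_def by blast
    then have "c \<le> N" using S(2)[OF u] by simp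
    then have "phase_bound D N (Suc c) = phase_bound D N c + 4 * D"
      by (simp add: phase_bound_def algebra_simps)
    then show ?thesis using S(1) by (simp add: phase_inv_def)
  qed
  ultimately show ?thesis using grow net unfolding guess_inv_def by blast
qed

lemma guess_inv_start: "guess_inv D N 0 (\<lambda>_. 0)"
  by (auto simp: guess_inv_def radius_le_def net_def separated_def intro: exI[of _ "{}"])

text \<open>A chosen point is labelled, as it lies in its own \<open>D\<close>-ball, so an
  unlabelled \<open>u\<close> could only be near the \<open>n - 1\<close> other indices. This is the
  reason why a loop of length \<open>n\<close> suffices without any knowledge of
  \<open>N\<close>.\<close>

lemma guess_inv_all_labelled:
  assumes "guess_inv D N n l" "u < n" "0 \<le> D"
  shows "l u \<noteq> 0"
proof
  assume lu: "l u = 0"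
  obtain S where S: "net D S l" "n \<le> card {s \<in> S. dd u s \<le> 4 * D}"
    using assms lu by (auto simp: guess_inv_def)
  then have "S \<subseteq> {..<n}" "u \<notin> S"
    using lu dd_refl[OF assms(2)] assms(2,3) unfolding net_def separated_def by force+
  then have "{s \<in> S. dd u s \<le> 4 * D} \<subseteq> {..<n} - {u}" by auto
  then have "card {s \<in> S. dd u s \<le> 4 * D} \<le> card ({..<n} - {u})" by (intro card_mono) auto
  then show False using S assms(2) by simp
qed

end

section \<open>The program\<close>

definition arr :: "store \<Rightarrow> vname \<Rightarrow> nat \<Rightarrow> nat" where
  "arr s a x = nmem s a x 0"

lemma arr_put [simp]: "a \<noteq> i \<Longrightarrow> arr (put i v s) a = arr s a"
  by (simp add: arr_def fun_eq_iff)

lemma arr_upd [simp]: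
  "arr (s\<lparr>nmem := upd m a i j v\<rparr>) b = (if b = a \<and> j = 0 then (\<lambda>x. m b x 0)(i := v) else (\<lambda>x. m b x 0))"
  by (auto simp: arr_def fun_eq_iff upd_apply)

lemma arr_rmem [simp]: "arr (s\<lparr>rmem := m\<rparr>) = arr s"
  by (simp add: arr_def fun_eq_iff)

lemma arr_cong: "nmem s a = nmem t a \<Longrightarrow> arr s a = arr t a"
  by (simp add: arr_def fun_eq_iff)

abbreviation Var :: "vname \<Rightarrow> nexp" where
  "Var v \<equiv> NLoad v (NConst 0) (NConst 0)"

abbreviation Cell :: "vname \<Rightarrow> vname \<Rightarrow> nexp" where
  "Cell a v \<equiv> NLoad a (Var v) (NConst 0)"

abbreviation Next :: "vname \<Rightarrow> nexp" where
  "Next v \<equiv> NAdd (Var v) (NConst 1)"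

abbreviation set_var :: "vname \<Rightarrow> nexp \<Rightarrow> prog" where
  "set_var v f \<equiv> NAssign v (NConst 0) (NConst 0) f"

abbreviation set_cell :: "vname \<Rightarrow> vname \<Rightarrow> nexp \<Rightarrow> prog" where
  "set_cell a v f \<equiv> NAssign a (Var v) (NConst 0) f"

abbreviation NonZero :: "nexp \<Rightarrow> bexp" where
  "NonZero f \<equiv> NLess (NConst 0) f"

abbreviation NEq :: "nexp \<Rightarrow> nexp \<Rightarrow> bexp" where
  "NEq f g \<equiv> BAnd (BNot (NLess f g)) (BNot (NLess g f))"

abbreviation RLe :: "rexp \<Rightarrow> rexp \<Rightarrow> bexp" where
  "RLe r q \<equiv> BNot (RLess q r)"

abbreviation Dist :: "vname \<Rightarrow> vname \<Rightarrow> rexp" where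
  "Dist v w \<equiv> RLoad ''d'' (Var v) (Var w)"

abbreviation RVar :: "vname \<Rightarrow> rexp" where
  "RVar v \<equiv> RLoad v (NConst 0) (NConst 0)"

abbreviation DTwice :: rexp where
  "DTwice \<equiv> RAdd (RVar ''D'') (RVar ''D'')"

definition prop_row :: prog where
  "prop_row = For ''y'' (When
     (BAnd (NonZero (NLoad ''A'' (Var ''x'') (Var ''y'')))
       (BAnd (NonZero (Cell ''lab'' ''x'')) (BNot (NonZero (Cell ''lab'' ''y'')))))
     (set_cell ''lab'' ''y'' (Cell ''lab'' ''x'')))"

definition prop_round :: prog where
  "prop_round = For ''x'' prop_row"

definition propagate :: prog where
  "propagate = For ''t'' prop_round"

text \<open>Adjacency is tabulated in \<open>''A''\<close> so that one propagation program serves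
  both the balls around chosen points and the old clusters during splitting.\<close>

definition table_row :: "bexp \<Rightarrow> prog" where
  "table_row b = For ''y'' (NAssign ''A'' (Var ''x'') (Var ''y'') (NConst 0) ;;
     When b (NAssign ''A'' (Var ''x'') (Var ''y'') (NConst 1)))"

definition table :: "bexp \<Rightarrow> prog" where
  "table b = For ''x'' (table_row b)"

definition near_test :: bexp where
  "near_test = BAnd (NonZero (NLoad ''E'' (Var ''x'') (Var ''y'')))
     (BAnd (RLe (Dist ''x'' ''w'') DTwice) (RLe (Dist ''y'' ''w'') DTwice))"

definition seed :: prog where
  "seed = For ''v'' (When (BAnd (RLe (Dist ''v'' ''w'') (RVar ''D'')) (BNot (NonZero (Cell ''lab'' ''v''))))
     (set_cell ''lab'' ''v'' (Next ''v'') ;; propagate))"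

definition block :: prog where
  "block = For ''x'' (When (RLe (Dist ''x'' ''w'') (RAdd DTwice DTwice))
     (set_cell ''blk'' ''x'' (NConst 1)))"

definition process :: prog where
  "process = table near_test ;; seed ;; block"

definition clear :: "vname \<Rightarrow> prog" where
  "clear a = For ''x'' (set_cell a ''x'' (NConst 0))"

definition visit :: prog where
  "visit = For ''w'' (When
     (BAnd (BNot (NonZero (Cell ''lab'' ''w''))) (BNot (NonZero (Cell ''blk'' ''w'')))) process)"

definition phase :: prog where
  "phase = clear ''blk'' ;; visit"

definition count :: prog where
  "count = set_var ''cnt'' (NConst 0) ;;
     For ''x'' (When (NEq (Cell ''lab'' ''x'') (Next ''x'')) (set_var ''cnt'' (Next ''cnt'')))"

definition guess :: prog where
  "guess = RAssign ''D'' (NConst 0) (NConst 0) (Dist ''a'' ''b'') ;; clear ''lab'' ;;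
     For ''c'' phase ;; count"

definition copy :: prog where
  "copy = For ''x'' (set_cell ''best'' ''x'' (Cell ''lab'' ''x''))"

text \<open>The flag guards the comparison because \<open>''bestD''\<close> has no meaning before
  the first success.\<close>

definition attempt :: prog where
  "attempt = guess ;; When (BAnd (BNot (NLess (Var ''k'') (Var ''cnt'')))
     (BNot (BAnd (NonZero (Var ''found'')) (RLe (RVar ''bestD'') (RVar ''D'')))))
     (set_var ''found'' (NConst 1) ;; RAssign ''bestD'' (NConst 0) (NConst 0) (RVar ''D'') ;; copy)"

definition search :: prog where
  "search = For ''a'' (For ''b'' attempt)"

definition old_roots :: prog where
  "old_roots = For ''x'' (set_cell ''lab'' ''x'' (NConst 0) ;;
     When (NEq (Cell ''best'' ''x'') (Next ''x'')) (set_cell ''lab'' ''x'' (Next ''x'')))"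

definition extra_roots :: prog where
  "extra_roots = For ''x'' (When
     (BAnd (BNot (NonZero (Cell ''lab'' ''x''))) (NLess (Var ''cnt'') (Var ''k'')))
     (set_cell ''lab'' ''x'' (Next ''x'') ;; set_var ''cnt'' (Next ''cnt'')))"

definition same_test :: bexp where
  "same_test = BAnd (NonZero (NLoad ''E'' (Var ''x'') (Var ''y'')))
     (NEq (Cell ''best'' ''x'') (Cell ''best'' ''y''))"

text \<open>\<open>extra_roots\<close> continues the counter left by \<open>count\<close>. The old
  clusters are read from \<open>''best''\<close>, as \<open>''lab''\<close> is being
  rebuilt.\<close>

definition split :: prog where
  "split = old_roots ;; count ;; extra_roots ;; table same_test ;; propagate"

definition number_roots :: prog where
  "number_roots = set_var ''cnt'' (NConst 0) ;;
     For ''x'' (When (NEq (Cell ''lab'' ''x'') (Next ''x''))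
       (set_cell ''num'' ''x'' (Var ''cnt'') ;; set_cell ''center'' ''cnt'' (Var ''x'') ;;
        set_var ''cnt'' (Next ''cnt'')))"

definition output_clusters :: prog where
  "output_clusters = For ''x'' (set_cell ''cluster'' ''x''
     (NLoad ''num'' (NSub (Cell ''lab'' ''x'') (NConst 1)) (NConst 0)))"

definition cluster_prog :: prog where
  "cluster_prog = search ;; split ;; number_roots ;; output_clusters"

lemmas prog_defs = prop_row_def prop_round_def propagate_def table_row_def table_def seed_def
  block_def process_def clear_def visit_def phase_def count_def guess_def copy_def attempt_def
  search_def old_roots_def extra_roots_def split_def number_roots_def output_clusters_def
  cluster_prog_def

lemma nwrites_progs [simp]:
  "nwrites prop_row = {''y'', ''lab''}"
  "nwrites prop_round = {''x'', ''y'', ''lab''}"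
  "nwrites propagate = {''t'', ''x'', ''y'', ''lab''}"
  "nwrites (table_row b) = {''y'', ''A''}"
  "nwrites (table b) = {''x'', ''y'', ''A''}"
  "nwrites seed = {''v'', ''t'', ''x'', ''y'', ''lab''}"
  "nwrites block = {''x'', ''blk''}"
  "nwrites process = {''v'', ''t'', ''x'', ''y'', ''lab'', ''A'', ''blk''}"
  "nwrites (clear a) = {''x'', a}"
  "nwrites visit = {''w'', ''v'', ''t'', ''x'', ''y'', ''lab'', ''A'', ''blk''}"
  "nwrites phase = {''w'', ''v'', ''t'', ''x'', ''y'', ''lab'', ''A'', ''blk''}"
  "nwrites count = {''x'', ''cnt''}"
  "nwrites guess = {''c'', ''w'', ''v'', ''t'', ''x'', ''y'', ''lab'', ''A'', ''blk'', ''cnt''}"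
  "nwrites copy = {''x'', ''best''}"
  "nwrites attempt = {''c'', ''w'', ''v'', ''t'', ''x'', ''y'', ''lab'', ''A'', ''blk'', ''cnt'',
     ''found'', ''best''}"
  "nwrites search = {''a'', ''b'', ''c'', ''w'', ''v'', ''t'', ''x'', ''y'', ''lab'', ''A'', ''blk'',
     ''cnt'', ''found'', ''best''}"
  "nwrites old_roots = {''x'', ''lab''}"
  "nwrites extra_roots = {''x'', ''lab'', ''cnt''}"
  "nwrites split = {''t'', ''x'', ''y'', ''lab'', ''A'', ''cnt''}"
  "nwrites number_roots = {''x'', ''num'', ''center'', ''cnt''}"
  "nwrites output_clusters = {''x'', ''cluster''}"
  by (auto simp: prog_defs)

lemma rwrites_progs [simp]:
  "rwrites prop_row = {}" "rwrites prop_round = {}" "rwrites propagate = {}"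
  "rwrites (table_row b) = {}" "rwrites (table b) = {}" "rwrites seed = {}" "rwrites block = {}"
  "rwrites process = {}" "rwrites (clear a) = {}" "rwrites visit = {}" "rwrites phase = {}"
  "rwrites count = {}" "rwrites guess = {''D''}" "rwrites copy = {}"
  "rwrites attempt = {''D'', ''bestD''}" "rwrites search = {''D'', ''bestD''}"
  "rwrites old_roots = {}" "rwrites extra_roots = {}" "rwrites split = {}"
  "rwrites number_roots = {}" "rwrites output_clusters = {}"
  by (auto simp: prog_defs)

lemma wf_progs [simp]:
  "wf_prog prop_row" "wf_prog prop_round" "wf_prog propagate" "wf_prog (table_row b)"
  "wf_prog (table b)" "wf_prog seed" "wf_prog block" "wf_prog process"
  "a \<noteq> ''x'' \<Longrightarrow> a \<noteq> ''n'' \<Longrightarrow> wf_prog (clear a)" "wf_prog visit" "wf_prog phase" "wf_prog count"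
  by (simp_all add: prog_defs)

lemma wf_progs' [simp]:
  "wf_prog guess" "wf_prog copy" "wf_prog attempt" "wf_prog search" "wf_prog old_roots"
  "wf_prog extra_roots" "wf_prog split" "wf_prog number_roots" "wf_prog output_clusters"
  "wf_prog cluster_prog"
  by (simp_all add: guess_def copy_def attempt_def search_def old_roots_def extra_roots_def
      split_def number_roots_def output_clusters_def cluster_prog_def)

section \<open>Propagation to a fixed point and the elementary loops\<close>

lemma run_prop_row:
  assumes "nmem s ''n'' 0 0 = n" "nmem s ''x'' 0 0 = x" "x < n"
    and A: "\<And>y. y < n \<Longrightarrow> nmem s ''A'' x y \<noteq> 0 \<longleftrightarrow> A x y"
  shows "(prop_step n A)\<^sup>*\<^sup>* (arr s ''lab'') (arr (run prop_row s) ''lab'') \<and>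
    (\<forall>y<n. A x y \<and> arr s ''lab'' x \<noteq> 0 \<longrightarrow> arr (run prop_row s) ''lab'' y \<noteq> 0)"
  unfolding prop_row_def
proof (rule For_rule[where I = "\<lambda>j t. (prop_step n A)\<^sup>*\<^sup>* (arr s ''lab'') (arr t ''lab'') \<and>
    (\<forall>y<j. A x y \<and> arr s ''lab'' x \<noteq> 0 \<longrightarrow> arr t ''lab'' y \<noteq> 0)"], goal_cases)
  case (4 j t)
  let ?l = "arr t ''lab''"
  let ?t = "put ''y'' (Suc j) (run (When
     (BAnd (NonZero (NLoad ''A'' (Var ''x'') (Var ''y'')))
       (BAnd (NonZero (Cell ''lab'' ''x'')) (BNot (NonZero (Cell ''lab'' ''y'')))))
     (set_cell ''lab'' ''y'' (Cell ''lab'' ''x''))) t)"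
  have "nmem t ''A'' = nmem s ''A''" "nmem t ''x'' 0 0 = x"
    using 4(3)[of "''A''"] 4(3)[of "''x''"] assms by simp_all
  then have l': "arr ?t ''lab'' = (if A x j \<and> ?l x \<noteq> 0 \<and> ?l j = 0 then ?l(j := ?l x) else ?l)"
    using 4(1,2) A[of j] by (auto simp: arr_def fun_eq_iff upd_apply)
  have "prop_step n A ?l (?l(j := ?l x))" if "A x j \<and> ?l x \<noteq> 0 \<and> ?l j = 0"
    using 4(1) assms(3) that unfolding prop_step_def by blast
  then have "(prop_step n A)\<^sup>*\<^sup>* ?l (arr ?t ''lab'')"
    unfolding l' by (auto intro: r_into_rtranclp)
  moreover have mono: "?l y \<noteq> 0 \<Longrightarrow> arr ?t ''lab'' y \<noteq> 0" for y
    using prop_steps_mono[OF calculation] by simp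
  \<comment> \<open>Labels never return to 0, so a source labelled at the start of the row is still
    labelled when column \<open>j\<close> is reached.\<close>
  moreover have "arr s ''lab'' x \<noteq> 0 \<Longrightarrow> ?l x \<noteq> 0"
    using 4(5) prop_steps_mono[of n A "arr s ''lab''" ?l x] by simp
  then have "A x j \<and> arr s ''lab'' x \<noteq> 0 \<longrightarrow> arr ?t ''lab'' j \<noteq> 0"
    unfolding l' by auto
  moreover have "(prop_step n A)\<^sup>*\<^sup>* (arr s ''lab'') (arr ?t ''lab'')"
    using 4(5) calculation(1) by (meson rtranclp_trans)
  ultimately show ?case using 4(5) unfolding less_Suc_eq by blast
qed (use assms in \<open>auto simp: prog_defs\<close>)

lemma run_prop_round:
  assumes "nmem s ''n'' 0 0 = n"
    and A: "\<And>x y. x < n \<Longrightarrow> y < n \<Longrightarrow> nmem s ''A'' x y \<noteq> 0 \<longleftrightarrow> A x y"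
  shows "(prop_step n A)\<^sup>*\<^sup>* (arr s ''lab'') (arr (run prop_round s) ''lab'') \<and>
    (\<forall>x<n. \<forall>y<n. A x y \<and> arr s ''lab'' x \<noteq> 0 \<longrightarrow> arr (run prop_round s) ''lab'' y \<noteq> 0)"
  unfolding prop_round_def
proof (rule For_rule[where I = "\<lambda>j t. (prop_step n A)\<^sup>*\<^sup>* (arr s ''lab'') (arr t ''lab'') \<and>
    (\<forall>x<j. \<forall>y<n. A x y \<and> arr s ''lab'' x \<noteq> 0 \<longrightarrow> arr t ''lab'' y \<noteq> 0)"], goal_cases)
  case (4 j t)
  let ?l = "arr t ''lab''" and ?l' = "arr (run prop_row t) ''lab''"
  have "nmem t ''A'' = nmem s ''A''" "nmem t ''n'' 0 0 = n"
    using 4(3)[of "''A''"] 4(3)[of "''n''"] assms by simp_all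
  then have row: "(prop_step n A)\<^sup>*\<^sup>* ?l ?l'" "\<forall>y<n. A j y \<and> ?l j \<noteq> 0 \<longrightarrow> ?l' y \<noteq> 0"
    using run_prop_row[of t n j A] 4(1,2) A by auto
  have "?l y \<noteq> 0 \<Longrightarrow> ?l' y \<noteq> 0" for y using prop_steps_mono[OF row(1)] by simp
  moreover have "arr s ''lab'' j \<noteq> 0 \<Longrightarrow> ?l j \<noteq> 0"
    using 4(5) prop_steps_mono[of n A "arr s ''lab''" ?l j] by simp
  ultimately show ?case using 4(5) row by (auto simp: less_Suc_eq)
qed (use assms in auto)

text \<open>A round that labels no new point leaves a saturated result, and every other round
  increases the number of labelled points. After \<open>n\<close> rounds the labelling is therefore
  saturated or complete, and completeness implies saturation.\<close>

lemma run_propagate: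
  assumes "nmem s ''n'' 0 0 = n"
    and A: "\<And>x y. x < n \<Longrightarrow> y < n \<Longrightarrow> nmem s ''A'' x y \<noteq> 0 \<longleftrightarrow> A x y"
  shows "propagated n A (arr s ''lab'') (arr (run propagate s) ''lab'')"
proof -
  let ?L = "\<lambda>l. {x. x < n \<and> l x \<noteq> (0::nat)}"
  have "(prop_step n A)\<^sup>*\<^sup>* (arr s ''lab'') (arr (run propagate s) ''lab'') \<and>
    (saturated n A (arr (run propagate s) ''lab'') \<or> n \<le> card (?L (arr (run propagate s) ''lab'')))"
    unfolding propagate_def
  proof (rule For_rule[where I = "\<lambda>j t. (prop_step n A)\<^sup>*\<^sup>* (arr s ''lab'') (arr t ''lab'') \<and>
      (saturated n A (arr t ''lab'') \<or> j \<le> card (?L (arr t ''lab'')))"], goal_cases)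
    case (4 j t)
    let ?l = "arr t ''lab''" and ?l' = "arr (run prop_round t) ''lab''"
    have "nmem t ''A'' = nmem s ''A''" "nmem t ''n'' 0 0 = n"
      using 4(3)[of "''A''"] 4(3)[of "''n''"] assms by simp_all
    then have rd: "(prop_step n A)\<^sup>*\<^sup>* ?l ?l'"
      "\<And>x y. x < n \<Longrightarrow> y < n \<Longrightarrow> A x y \<Longrightarrow> ?l x \<noteq> 0 \<Longrightarrow> ?l' y \<noteq> 0"
      using run_prop_round[of t n A] A by auto
    have sub: "?L ?l \<subseteq> ?L ?l'" using prop_steps_mono[OF rd(1)] by auto
    have "saturated n A ?l' \<or> Suc j \<le> card (?L ?l')"
    proof (cases "?L ?l' = ?L ?l")
      case True
      then have "?l x \<noteq> 0 \<longleftrightarrow> ?l' x \<noteq> 0" if "x < n" for x using that by blast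
      then show ?thesis using rd(2) unfolding saturated_def by blast
    next
      case False
      then have "card (?L ?l) < card (?L ?l')" using sub by (intro psubset_card_mono) auto
      moreover have "\<not> saturated n A ?l"
      proof
        \<comment> \<open>A saturated labelling admits no step at all, so the round could not have
          labelled anything.\<close>
        assume sat: "saturated n A ?l"
        have eq: "l2 = ?l" if "(prop_step n A)\<^sup>*\<^sup>* ?l l2" for l2
          using that
        proof (induction rule: rtranclp_induct)
          case (step l1 l2)
          then have "prop_step n A ?l l2" by simp
          then show ?case using sat unfolding prop_step_def saturated_def by blast
        qed simp
        show False using eq[OF rd(1)] False by simp
      qed
      ultimately show ?thesis using 4(5) by auto
    qed
    then show ?case using 4(5) rd(1) by auto
  qed (use assms in auto)
  moreover have "saturated n A l" if "n \<le> card (?L l)" for l :: "nat \<Rightarrow> nat"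
  proof -
    have "?L l = {..<n}" using that by (intro card_seteq) auto
    then show ?thesis by (auto simp: saturated_def)
  qed
  ultimately show ?thesis unfolding propagated_def by blast
qed

text \<open>The test is evaluated in stores that differ from \<open>s\<close> in the two counters
  and the table itself, so it has to be determined by the indices and the remaining data.\<close>

lemma run_table:
  assumes "nmem s ''n'' 0 0 = n"
    and P: "\<And>t x y. \<lbrakk>x < n; y < n; \<And>a. a \<notin> {''x'', ''y'', ''A''} \<Longrightarrow> nmem t a = nmem s a; rmem t = rmem s;
      nmem t ''x'' 0 0 = x; nmem t ''y'' 0 0 = y\<rbrakk> \<Longrightarrow> bval b t \<longleftrightarrow> P x y"
  shows "\<forall>x<n. \<forall>y<n. nmem (run (table b) s) ''A'' x y \<noteq> 0 \<longleftrightarrow> P x y"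
  unfolding table_def
proof (rule For_rule[where I = "\<lambda>j t. \<forall>x<j. \<forall>y<n. nmem t ''A'' x y \<noteq> 0 \<longleftrightarrow> P x y"], goal_cases)
  case (4 j t)
  have "(\<forall>x y. x \<noteq> j \<longrightarrow> nmem (run (table_row b) t) ''A'' x y = nmem t ''A'' x y) \<and>
    (\<forall>y<n. nmem (run (table_row b) t) ''A'' j y \<noteq> 0 \<longleftrightarrow> P j y)"
    unfolding table_row_def
  proof (rule For_rule[where I = "\<lambda>i u. (\<forall>x y. x \<noteq> j \<longrightarrow> nmem u ''A'' x y = nmem t ''A'' x y) \<and>
    (\<forall>y<i. nmem u ''A'' j y \<noteq> 0 \<longleftrightarrow> P j y)"], goal_cases)
    case (4 i u)
    let ?u = "u\<lparr>nmem := upd (nmem u) ''A'' j i 0\<rparr>"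
    have x: "nmem u ''x'' 0 0 = j" using 4(3)[of "''x''"] \<open>nmem t ''x'' 0 0 = j\<close> by simp
    have "nmem ?u a = nmem s a" if "a \<notin> {''x'', ''y'', ''A''}" for a
      using that 4(3)[of a] \<open>\<And>a. a \<notin> insert ''x'' (nwrites (table_row b)) \<Longrightarrow> nmem t a = nmem s a\<close>[of a]
      by simp
    moreover have "rmem ?u = rmem s"
      using 4(4) \<open>\<And>a. a \<notin> rwrites (table_row b) \<Longrightarrow> rmem t a = rmem s a\<close> by (simp add: fun_eq_iff)
    ultimately have "bval b ?u \<longleftrightarrow> P j i"
      using P[of j i ?u] x 4(1,2) \<open>j < n\<close> by simp
    then show ?case using 4(2,5) x by (auto simp: upd_apply less_Suc_eq)
  qed (use 4(3)[of "''n''"] assms in auto)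
  then show ?case using 4(5) by (auto simp: less_Suc_eq)
qed (use assms in auto)

lemma run_clear:
  assumes "nmem s ''n'' 0 0 = n" "a \<noteq> ''x''" "a \<noteq> ''n''"
  shows "arr (run (clear a) s) a = (\<lambda>x. if x < n then 0 else arr s a x)"
  unfolding clear_def
proof (rule For_rule[where I = "\<lambda>j t. arr t a = (\<lambda>x. if x < j then 0 else arr s a x)"], goal_cases)
  case (4 j t)
  then show ?case using assms by (auto simp: less_Suc_eq arr_def fun_eq_iff upd_apply)
qed (use assms in auto)

lemma run_copy:
  assumes "nmem s ''n'' 0 0 = n"
  shows "\<forall>x<n. arr (run copy s) ''best'' x = arr s ''lab'' x"
  unfolding copy_def
proof (rule For_rule[where I = "\<lambda>j t. \<forall>x<j. arr t ''best'' x = arr s ''lab'' x"], goal_cases)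
  case (4 j t)
  then show ?case using 4(3)[of "''lab''"] by (auto simp: less_Suc_eq arr_def)
qed (use assms in auto)

lemma roots_Suc: "roots (Suc j) l = (if l j = Suc j then insert j (roots j l) else roots j l)"
  by (auto simp: roots_def less_Suc_eq)

lemma run_count:
  assumes "nmem s ''n'' 0 0 = n"
  shows "nmem (run count s) ''cnt'' 0 0 = card (roots n (arr s ''lab''))"
proof -
  let ?s = "s\<lparr>nmem := upd (nmem s) ''cnt'' 0 0 0\<rparr>"
  have "nmem (run (For ''x'' (When (NEq (Cell ''lab'' ''x'') (Next ''x''))
      (set_var ''cnt'' (Next ''cnt'')))) ?s) ''cnt'' 0 0 = card (roots n (arr s ''lab''))"
  proof (rule For_rule[where I = "\<lambda>j t. nmem t ''cnt'' 0 0 = card (roots j (arr s ''lab''))"], goal_cases)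
    case (4 j t)
    have "j \<notin> roots j (arr s ''lab'')" by (simp add: roots_def)
    then show ?case using 4 4(3)[of "''lab''"] by (auto simp: roots_Suc upd_apply arr_def)
  qed (use assms in \<open>auto simp: roots_def upd_apply\<close>)
  then show ?thesis by (simp add: count_def)
qed

section \<open>One phase as carried out by the program\<close>

context index_metric
begin

text \<open>The input arrays are read-only throughout, so the property passes to the store before
  every subprogram.\<close>

definition input_ok :: "nat \<Rightarrow> store \<Rightarrow> bool" where
  "input_ok k s \<longleftrightarrow> nmem s ''n'' 0 0 = n \<and> nmem s ''k'' 0 0 = k \<and>
     (\<forall>x<n. \<forall>y<n. (nmem s ''E'' x y \<noteq> 0 \<longleftrightarrow> e x y) \<and> rmem s ''d'' x y = dd x y)"

lemma input_ok_run [simp]: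
  assumes "input_ok k s" "''n'' \<notin> nwrites p" "''k'' \<notin> nwrites p" "''E'' \<notin> nwrites p" "''d'' \<notin> rwrites p"
  shows "input_ok k (run p s)"
  using assms by (simp add: input_ok_def run_frame)

lemma input_ok_n: "input_ok k s \<Longrightarrow> nmem s ''n'' 0 0 = n"
  by (simp add: input_ok_def)

lemma run_seed:
  assumes s: "input_ok k s" and w: "nmem s ''w'' 0 0 = w" "w < n" and D: "rmem s ''D'' 0 0 = D"
    and A: "\<And>x y. x < n \<Longrightarrow> y < n \<Longrightarrow> nmem s ''A'' x y \<noteq> 0 \<longleftrightarrow> near D w x y"
  shows "(root_step D w)\<^sup>*\<^sup>* (arr s ''lab'') (arr (run seed s) ''lab'') \<and>
    (\<forall>v<n. dd v w \<le> D \<longrightarrow> arr (run seed s) ''lab'' v \<noteq> 0)"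
  unfolding seed_def
proof (rule For_rule[where I = "\<lambda>j t. (root_step D w)\<^sup>*\<^sup>* (arr s ''lab'') (arr t ''lab'') \<and>
    (\<forall>v<j. dd v w \<le> D \<longrightarrow> arr t ''lab'' v \<noteq> 0)"], goal_cases)
  case (4 j t)
  let ?p = "set_cell ''lab'' ''v'' (Next ''v'') ;; propagate"
  let ?b = "BAnd (RLe (Dist ''v'' ''w'') (RVar ''D'')) (BNot (NonZero (Cell ''lab'' ''v'')))"
  let ?l = "arr t ''lab''"
  have t: "input_ok k t" using s by (simp add: input_ok_def 4(3,4))
  have "nmem t ''w'' 0 0 = w" "rmem t = rmem s" "nmem t ''A'' = nmem s ''A''"
    using 4(3)[of "''w''"] 4(3)[of "''A''"] 4(4) w by (simp_all add: fun_eq_iff)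
  then have b: "bval ?b t \<longleftrightarrow> dd j w \<le> D \<and> ?l j = 0"
    using t w 4(1,2) D by (auto simp: input_ok_def arr_def)
  show ?case
  proof (cases "bval ?b t")
    case False
    then show ?thesis using b 4(5) by (auto simp: less_Suc_eq)
  next
    case True
    let ?t = "t\<lparr>nmem := upd (nmem t) ''lab'' j 0 (Suc j)\<rparr>"
    have "propagated n (near D w) (arr ?t ''lab'') (arr (run propagate ?t) ''lab'')"
      by (rule run_propagate) (use t A \<open>nmem t ''A'' = _\<close> in \<open>auto simp: input_ok_n\<close>)
    moreover have "arr ?t ''lab'' = ?l(j := Suc j)" by (simp add: arr_def fun_eq_iff)
    moreover have "run ?p t = run propagate ?t" using 4(2) by simp
    ultimately have step: "root_step D w ?l (arr (run ?p t) ''lab'')"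
      and pr: "propagated n (near D w) (?l(j := Suc j)) (arr (run ?p t) ''lab'')"
      using True b 4(1) unfolding root_step_def by auto
    have "arr (run ?p t) ''lab'' j \<noteq> 0"
      using prop_steps_mono[OF pr[unfolded propagated_def, THEN conjunct1], of j]
      by (simp del: run.simps)
    moreover have "?l x \<noteq> 0 \<Longrightarrow> arr (run ?p t) ''lab'' x \<noteq> 0" for x
      using root_step_mono[OF step, of x] by simp
    moreover have "(root_step D w)\<^sup>*\<^sup>* (arr s ''lab'') (arr (run ?p t) ''lab'')"
      using 4(5) step by (meson rtranclp.rtrancl_into_rtrancl)
    ultimately show ?thesis using 4(5) True
      by (auto simp del: run.simps(1-3) bval.simps simp: less_Suc_eq)
  qed
qed (use assms in \<open>auto simp: input_ok_n\<close>)

lemma run_block: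
  assumes s: "input_ok k s" and w: "nmem s ''w'' 0 0 = w" "w < n" and D: "rmem s ''D'' 0 0 = D"
  shows "\<forall>x<n. arr (run block s) ''blk'' x \<noteq> 0 \<longleftrightarrow> arr s ''blk'' x \<noteq> 0 \<or> dd x w \<le> 4 * D"
proof -
  \<comment> \<open>The second conjunct keeps the old contents available for cells that the loop has
    not reached yet.\<close>
  have "(\<forall>x<n. arr (run block s) ''blk'' x \<noteq> 0 \<longleftrightarrow> arr s ''blk'' x \<noteq> 0 \<or> dd x w \<le> 4 * D) \<and>
    (\<forall>x\<ge>n. arr (run block s) ''blk'' x = arr s ''blk'' x)"
    unfolding block_def
  proof (rule For_rule[where I = "\<lambda>j t.
      (\<forall>x<j. arr t ''blk'' x \<noteq> 0 \<longleftrightarrow> arr s ''blk'' x \<noteq> 0 \<or> dd x w \<le> 4 * D) \<and>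
      (\<forall>x\<ge>j. arr t ''blk'' x = arr s ''blk'' x)"], goal_cases)
    case (4 j t)
    have t: "input_ok k t" using s by (simp add: input_ok_def 4(3,4))
    have "nmem t ''w'' 0 0 = w" "rmem t = rmem s"
      using 4(3)[of "''w''"] 4(4) w by (simp_all add: fun_eq_iff)
    then have "bval (RLe (Dist ''x'' ''w'') (RAdd DTwice DTwice)) t \<longleftrightarrow> dd j w \<le> 4 * D"
      using t w 4(1,2) D by (auto simp: input_ok_def)
    then have "arr (put ''x'' (Suc j) (run (When (RLe (Dist ''x'' ''w'') (RAdd DTwice DTwice))
      (set_cell ''blk'' ''x'' (NConst 1))) t)) ''blk'' =
      (if dd j w \<le> 4 * D then (arr t ''blk'')(j := 1) else arr t ''blk'')"
      using 4(2) by (simp add: arr_def fun_eq_iff upd_apply)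
    then show ?case using 4(5) by (auto simp: less_Suc_eq)
  qed (use assms in \<open>auto simp: input_ok_n\<close>)
  then show ?thesis by blast
qed

lemma run_process:
  assumes s: "input_ok k s" and w: "nmem s ''w'' 0 0 = w" "w < n" and D: "rmem s ''D'' 0 0 = D"
  shows "(root_step D w)\<^sup>*\<^sup>* (arr s ''lab'') (arr (run process s) ''lab'') \<and>
    (\<forall>v<n. dd v w \<le> D \<longrightarrow> arr (run process s) ''lab'' v \<noteq> 0) \<and>
    (\<forall>x<n. arr (run process s) ''blk'' x \<noteq> 0 \<longleftrightarrow> arr s ''blk'' x \<noteq> 0 \<or> dd x w \<le> 4 * D)"
proof -
  let ?s1 = "run (table near_test) s"
  let ?s2 = "run seed ?s1"
  have A: "\<forall>x<n. \<forall>y<n. nmem ?s1 ''A'' x y \<noteq> 0 \<longleftrightarrow> near D w x y"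
  proof (rule run_table)
    fix t :: store and x y
    assume xy: "x < n" "y < n" "nmem t ''x'' 0 0 = x" "nmem t ''y'' 0 0 = y" "rmem t = rmem s"
      and fr: "\<And>a. a \<notin> {''x'', ''y'', ''A''} \<Longrightarrow> nmem t a = nmem s a"
    show "bval near_test t \<longleftrightarrow> near D w x y"
      using xy fr[of "''w''"] fr[of "''E''"] s w D by (auto simp: near_test_def near_def input_ok_def)
  qed (use s in \<open>simp add: input_ok_n\<close>)
  have s1: "input_ok k ?s1" "nmem ?s1 ''w'' 0 0 = w" "rmem ?s1 ''D'' 0 0 = D"
    "arr ?s1 ''lab'' = arr s ''lab''" "arr ?s1 ''blk'' = arr s ''blk''"
    using s w D by (auto simp: run_frame intro: arr_cong)
  have s2: "input_ok k ?s2" "nmem ?s2 ''w'' 0 0 = w" "rmem ?s2 ''D'' 0 0 = D"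
    "arr ?s2 ''blk'' = arr s ''blk''" "arr (run block ?s2) ''lab'' = arr ?s2 ''lab''"
    using s1 by (auto simp: run_frame arr_cong[OF run_frame(1)])
  show ?thesis
    using run_seed[OF s1(1,2) w(2) s1(3)] run_block[OF s2(1,2) w(2) s2(3)] A s1 s2
    by (simp add: process_def)
qed

text \<open>The set \<open>W\<close> of choices is not stored. \<open>''blk''\<close> records the
  points within \<open>4 * D\<close> of it, which is all that the scan asks about
  \<open>W\<close>.\<close>

lemma run_visit:
  assumes s: "input_ok k s" and D: "rmem s ''D'' 0 0 = D" "0 \<le> D"
    and blk: "\<forall>x<n. arr s ''blk'' x = 0" and inv: "guess_inv D N c (arr s ''lab'')"
    and pack: "packing_le N"
  shows "guess_inv D N (Suc c) (arr (run visit s) ''lab'')"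
proof -
  let ?l = "arr s ''lab''"
  let ?B = "\<lambda>W t. \<forall>x<n. arr t ''blk'' x \<noteq> 0 \<longleftrightarrow> (\<exists>w\<in>W. dd x w \<le> 4 * D)"
  let ?b = "BAnd (BNot (NonZero (Cell ''lab'' ''w''))) (BNot (NonZero (Cell ''blk'' ''w'')))"
  have "\<exists>W. phase_state D N c ?l n W (arr (run visit s) ''lab'') \<and> ?B W (run visit s)"
    unfolding visit_def
  proof (rule For_rule[where I = "\<lambda>j t. \<exists>W. phase_state D N c ?l j W (arr t ''lab'') \<and> ?B W t"], goal_cases)
    case 3
    show ?case using phase_state_start[OF inv D(2)] blk by (intro exI[of _ "{}"]) simp
  next
    case (4 j t)
    have t: "input_ok k t" using s by (simp add: input_ok_def 4(3,4))
    have tD: "rmem t ''D'' 0 0 = D" using 4(4)[of "''D''"] D by simp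
    obtain W where W: "phase_state D N c ?l j W (arr t ''lab'')" "?B W t" using 4(5) by blast
    show ?case
    proof (cases "bval ?b t")
      case False
      then have "arr t ''lab'' j \<noteq> 0 \<or> (\<exists>w\<in>W. dd j w \<le> 4 * D)"
        using W(2) 4(1,2) by (auto simp: arr_def)
      from phase_state_skip[OF W(1) this] show ?thesis
        using False W(2) by (intro exI[of _ W]) (simp del: bval.simps)
    next
      case True
      then have j: "arr t ''lab'' j = 0" "\<not> (\<exists>w\<in>W. dd j w \<le> 4 * D)"
        using W(2) 4(1,2) by (auto simp: arr_def)
      note run = run_process[OF t 4(2,1) tD]
      have "phase_state D N c ?l (Suc j) (insert j W) (arr (run process t) ''lab'')"
        by (rule phase_state_process[OF W(1) D(2) 4(1) j]) (use run in auto)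
      moreover have "?B (insert j W) (run process t)" using run W(2) by auto
      ultimately show ?thesis using True by (intro exI[of _ "insert j W"]) (simp del: bval.simps)
    qed
  qed (use s in \<open>auto simp: input_ok_n\<close>)
  then show ?thesis using phase_state_end[OF _ inv pack D(2)] by blast
qed

lemma run_phase:
  assumes s: "input_ok k s" and D: "rmem s ''D'' 0 0 = D" "0 \<le> D"
    and inv: "guess_inv D N c (arr s ''lab'')" and pack: "packing_le N"
  shows "guess_inv D N (Suc c) (arr (run phase s) ''lab'')"
proof -
  let ?s = "run (clear ''blk'') s"
  have "input_ok k ?s" "rmem ?s ''D'' 0 0 = D" "arr ?s ''lab'' = arr s ''lab''"
    using s D by (auto simp: run_frame intro: arr_cong)
  moreover have "\<forall>x<n. arr ?s ''blk'' x = 0"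
    using run_clear[of s n "''blk''"] s by (simp add: input_ok_n)
  ultimately show ?thesis
    using run_visit[of k ?s D N c] D(2) inv pack by (simp add: phase_def)
qed

end

section \<open>Refining a clustering by additional roots\<close>

lemma prop_steps_outside:
  assumes "(prop_step n A)\<^sup>*\<^sup>* l l'" "n \<le> x"
  shows "l' x = l x"
  using assms
proof (induction rule: rtranclp_induct)
  case (step l1 l2)
  then have "l2 x = l1 x" unfolding prop_step_def by fastforce
  then show ?case using step by simp
qed simp

text \<open>Each old cluster keeps its old root and is connected to it inside the cluster, so
  propagation along edges within old clusters reaches every point. No label ever leaves the old
  cluster in which it started.\<close>

lemma split_labelling:
  assumes l: "rooted n e l" "\<And>x. x < n \<Longrightarrow> l x \<noteq> 0"
    and l\<^sub>1: "\<And>x. x < n \<Longrightarrow> l\<^sub>1 x \<in> {0, Suc x}" "roots n l \<subseteq> roots n l\<^sub>1"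
    and l\<^sub>2: "propagated n (\<lambda>x y. e x y \<and> l x = l y) l\<^sub>1 l\<^sub>2"
  shows "rooted n e l\<^sub>2 \<and> roots n l\<^sub>2 = roots n l\<^sub>1 \<and> (\<forall>x<n. l\<^sub>2 x \<noteq> 0 \<and> l (l\<^sub>2 x - 1) = l x)"
proof (intro conjI allI impI)
  let ?A = "\<lambda>x y. e x y \<and> l x = l y"
  have steps: "(prop_step n ?A)\<^sup>*\<^sup>* l\<^sub>1 l\<^sub>2" and sat: "saturated n ?A l\<^sub>2"
    using l\<^sub>2 by (auto simp: propagated_def)
  \<comment> \<open>Under \<open>l\<^sub>1\<close> every labelled point is its own root.\<close>
  have "rooted n e l\<^sub>1" using l\<^sub>1(1) by (force simp: rooted_def)
  then have *: "rooted n e l\<^sub>2 \<and> roots n l\<^sub>2 = roots n l\<^sub>1"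
    by (intro rooted_prop_steps[of n e l\<^sub>1] prop_steps_weaken[OF steps]) auto
  show "rooted n e l\<^sub>2" "roots n l\<^sub>2 = roots n l\<^sub>1" using * by auto
  fix x assume x: "x < n"
  have r: "l x - 1 < n" "l (l x - 1) = l x" "(l x - 1, x) \<in> (class_rel n e l (l x))\<^sup>*"
    using l x by (auto simp: rooted_def)
  have "l x - 1 \<in> roots n l" using r l(2)[OF x] by (simp add: roots_def)
  then have "l x - 1 \<in> roots n l\<^sub>2" using l\<^sub>1(2) * by auto
  then have "l\<^sub>2 (l x - 1) \<noteq> 0" by (simp add: roots_def)
  then show nz: "l\<^sub>2 x \<noteq> 0"
    by (rule saturated_class[OF sat r(3)]) simp
  have "\<forall>x<n. l\<^sub>2 x \<noteq> 0 \<longrightarrow> l (l\<^sub>2 x - 1) = l x"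
    using steps
  proof (induction rule: rtranclp_induct)
    case base
    then show ?case using l\<^sub>1(1) by force
  next
    case (step la lb)
    then obtain u v where "u < n" "v < n" "l u = l v" "la u \<noteq> 0" "lb = la(v := la u)"
      unfolding prop_step_def by blast
    then show ?case using step.IH by simp
  qed
  then show "l (l\<^sub>2 x - 1) = l x" using x nz by blast
qed

section \<open>Searching for the smallest successful guess\<close>

context index_metric
begin

text \<open>Growth is defined from the labelling that is 0 everywhere, but the program resets only
  indices below \<open>n\<close>. The other cells must therefore still be 0 when the next guess
  begins.\<close>

lemma grow_steps_outside:
  assumes "(grow_step D)\<^sup>*\<^sup>* (\<lambda>_. 0) l" "n \<le> x"
  shows "l x = 0"
  using assms
proof (induction rule: rtranclp_induct)
  case (step l1 l2)
  then obtain w v where "v < n" "propagated n (near D w) (l1(v := Suc v)) l2"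
    unfolding grow_step_def root_step_def by blast
  then have "l2 x = l1 x"
    using prop_steps_outside[of n "near D w" "l1(v := Suc v)" l2 x] step.prems
    by (simp add: propagated_def)
  then show ?case using step by simp
qed simp

definition feasible :: "nat \<Rightarrow> real \<Rightarrow> bool" where
  "feasible k D \<longleftrightarrow> (\<exists>p :: nat \<Rightarrow> nat. partition_diam D p \<and> p ` {..<n} \<subseteq> {..<k})"

definition good :: "real \<Rightarrow> nat \<Rightarrow> (nat \<Rightarrow> nat) \<Rightarrow> bool" where
  "good B k l \<longleftrightarrow> rooted n e l \<and> (\<forall>x<n. l x \<noteq> 0) \<and> radius_le B l \<and> card (roots n l) \<le> k"

lemma run_guess:
  assumes s: "input_ok k s" and ab: "nmem s ''a'' 0 0 = a" "nmem s ''b'' 0 0 = b" "a < n" "b < n"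
    and out: "\<forall>x\<ge>n. arr s ''lab'' x = 0" and pack: "packing_le N"
  shows "guess_inv (dd a b) N n (arr (run guess s) ''lab'') \<and> rmem (run guess s) ''D'' 0 0 = dd a b \<and>
    nmem (run guess s) ''cnt'' 0 0 = card (roots n (arr (run guess s) ''lab''))"
proof -
  let ?s1 = "run (RAssign ''D'' (NConst 0) (NConst 0) (Dist ''a'' ''b'')) s"
  let ?s2 = "run (clear ''lab'') ?s1"
  let ?s3 = "run (For ''c'' phase) ?s2"
  have s1: "input_ok k ?s1" "rmem ?s1 ''D'' 0 0 = dd a b" "arr ?s1 ''lab'' = arr s ''lab''"
    using s ab by (auto simp: input_ok_def upd_apply)
  have s2: "input_ok k ?s2" "rmem ?s2 ''D'' 0 0 = dd a b"
    using s1 by (auto simp: run_frame simp del: run.simps)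
  have "arr ?s2 ''lab'' = (\<lambda>x. if x < n then 0 else arr ?s1 ''lab'' x)"
    by (rule run_clear) (use input_ok_n[OF s1(1)] in \<open>simp_all del: run.simps\<close>)
  also have "\<dots> = (\<lambda>_. 0)"
    using out unfolding s1(3) by (auto simp: fun_eq_iff)
  finally have lab: "arr ?s2 ''lab'' = (\<lambda>_. 0)" .
  have D: "0 \<le> dd a b" using dd_nonneg ab by simp
  have inv: "guess_inv (dd a b) N n (arr ?s3 ''lab'')"
  proof (rule For_rule[where I = "\<lambda>j t. guess_inv (dd a b) N j (arr t ''lab'')"], goal_cases)
    case (4 j t)
    have t: "input_ok k t" using s2(1) by (simp add: input_ok_def 4(3,4) del: run.simps)
    have tD: "rmem t ''D'' 0 0 = dd a b" using s2(2) 4(4) by (simp del: run.simps)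
    show ?case using run_phase[OF t tD D 4(5) pack] by simp
  qed (use s2 lab guess_inv_start in \<open>auto simp: input_ok_n simp del: run.simps\<close>)
  have s3: "input_ok k ?s3" "rmem ?s3 ''D'' 0 0 = dd a b"
    using s2 by (auto simp: run_frame simp del: run.simps)
  have run: "run guess s = run count ?s3" by (simp add: guess_def del: run.simps(1,2,5))
  have "arr (run count ?s3) ''lab'' = arr ?s3 ''lab''"
    by (rule arr_cong) (simp add: run_frame del: run.simps)
  moreover have "rmem (run count ?s3) ''D'' = rmem ?s3 ''D''"
    by (simp add: run_frame del: run.simps)
  ultimately show ?thesis
    using inv s3 run_count[OF input_ok_n[OF s3(1)]] unfolding run by simp
qed

text \<open>\<open>Q\<close> holds the pairs tried so far. An accepted guess is good by virtue of
  its few roots, feasible or not; feasibility only serves to bound \<open>''bestD''\<close> from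
  above. The labelling \<open>l\<close> is existential because \<open>''best''\<close> matches it
  only below \<open>n\<close>.\<close>

definition search_inv :: "nat \<Rightarrow> nat \<Rightarrow> (nat \<times> nat) set \<Rightarrow> store \<Rightarrow> bool" where
  "search_inv k N Q s \<longleftrightarrow> input_ok k s \<and> (\<forall>x\<ge>n. arr s ''lab'' x = 0) \<and>
     (nmem s ''found'' 0 0 \<noteq> 0 \<longrightarrow>
       (\<exists>l. (\<forall>x<n. arr s ''best'' x = l x) \<and> good (4 * rmem s ''bestD'' 0 0 * real (Suc N)) k l)) \<and>
     (\<forall>(a, b)\<in>Q. feasible k (dd a b) \<longrightarrow>
       nmem s ''found'' 0 0 \<noteq> 0 \<and> rmem s ''bestD'' 0 0 \<le> dd a b)"

lemma search_inv_put [simp]: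
  assumes "i \<notin> {''n'', ''k'', ''E'', ''lab'', ''best'', ''found''}"
  shows "search_inv k N Q (put i v s) \<longleftrightarrow> search_inv k N Q s"
  using assms by (auto simp: search_inv_def input_ok_def)

lemma run_attempt:
  assumes inv: "search_inv k N Q s"
    and ab: "nmem s ''a'' 0 0 = a" "nmem s ''b'' 0 0 = b" "a < n" "b < n" and pack: "packing_le N"
  shows "search_inv k N (insert (a, b) Q) (run attempt s)"
proof -
  let ?D = "dd a b"
  define t where "t = run guess s"
  let ?l = "arr t ''lab''"
  let ?b = "BAnd (BNot (NLess (Var ''k'') (Var ''cnt'')))
     (BNot (BAnd (NonZero (Var ''found'')) (RLe (RVar ''bestD'') (RVar ''D''))))"
  let ?p = "set_var ''found'' (NConst 1) ;; RAssign ''bestD'' (NConst 0) (NConst 0) (RVar ''D'') ;; copy"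
  have s: "input_ok k s" "\<forall>x\<ge>n. arr s ''lab'' x = 0" using inv by (auto simp: search_inv_def)
  have g: "guess_inv ?D N n ?l" "rmem t ''D'' 0 0 = ?D" "nmem t ''cnt'' 0 0 = card (roots n ?l)"
    using run_guess[OF s(1) ab s(2) pack] by (auto simp: t_def)
  have grow: "(grow_step ?D)\<^sup>*\<^sup>* (\<lambda>_. 0) ?l" using g(1) by (simp add: guess_inv_def)
  have t: "input_ok k t" "\<forall>x\<ge>n. ?l x = 0"
    using s(1) grow_steps_outside[OF grow] by (auto simp: t_def)
  have fr: "nmem t ''found'' = nmem s ''found''" "arr t ''best'' = arr s ''best''"
    "rmem t ''bestD'' = rmem s ''bestD''"
    by (auto simp: t_def run_frame intro!: arr_cong)
  have "search_inv k N Q t" using inv t fr by (simp add: search_inv_def)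
  have D: "0 \<le> ?D" using dd_nonneg ab by simp
  \<comment> \<open>A feasible guess always passes the test on the number of roots.\<close>
  have feas: "card (roots n ?l) \<le> k" if "feasible k ?D"
    using that card_roots_le[OF grow] unfolding feasible_def by blast
  have b: "bval ?b t \<longleftrightarrow> card (roots n ?l) \<le> k \<and> \<not> (nmem t ''found'' 0 0 \<noteq> 0 \<and> rmem t ''bestD'' 0 0 \<le> ?D)"
    using t(1) g(2,3) by (auto simp: input_ok_def)
  have run: "run attempt s = run (When ?b ?p) t"
    by (simp add: attempt_def t_def del: run.simps(1,2,4,5))
  show ?thesis
  proof (cases "bval ?b t")
    case False
    then have "run attempt s = t" unfolding run by (simp del: bval.simps)
    moreover have "search_inv k N (insert (a, b) Q) t"
      using \<open>search_inv k N Q t\<close> False feas unfolding b by (auto simp: search_inv_def)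
    ultimately show ?thesis by simp
  next
    case True
    define u where "u = t\<lparr>nmem := upd (nmem t) ''found'' 0 0 1, rmem := upd (rmem t) ''bestD'' 0 0 ?D\<rparr>"
    have r: "run attempt s = run copy u"
      using True g(2) unfolding run by (simp add: u_def del: bval.simps)
    have u: "input_ok k u" "nmem u ''found'' 0 0 = 1" "rmem u ''bestD'' 0 0 = ?D" "arr u ''lab'' = ?l"
      using t(1) by (auto simp: u_def input_ok_def upd_apply arr_def fun_eq_iff)
    let ?c = "run copy u"
    have c: "input_ok k ?c" "nmem ?c ''found'' 0 0 = 1" "rmem ?c ''bestD'' 0 0 = ?D" "arr ?c ''lab'' = ?l"
      using u by (auto simp: run_frame arr_cong[OF run_frame(1)])
    have best: "\<forall>x<n. arr ?c ''best'' x = ?l x"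
      using run_copy[OF input_ok_n[OF u(1)]] u(4) by simp
    \<comment> \<open>The minimum in \<open>phase_bound\<close> removes the dependence on the number
      \<open>n\<close> of phases.\<close>
    have "phase_bound ?D N n \<le> 4 * ?D * real (Suc N)"
      unfolding phase_bound_def using D by (intro mult_left_mono) auto
    then have "radius_le (4 * ?D * real (Suc N)) ?l"
      using g(1) unfolding guess_inv_def radius_le_def by (meson order_trans)
    moreover have "rooted n e ?l" using grow_steps[OF grow, where ?'b = nat] by simp
    ultimately have "good (4 * ?D * real (Suc N)) k ?l"
      using guess_inv_all_labelled[OF g(1) _ D] True unfolding b good_def by blast
    \<comment> \<open>The update happens either before any success, when no earlier pair was
      feasible, or because \<open>?D\<close> beats the old value, which was below all earlier
      feasible guesses.\<close>
    moreover have "?D \<le> dd a' b'" if "(a', b') \<in> insert (a, b) Q" "feasible k (dd a' b')" for a' b'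
    proof (cases "(a', b') = (a, b)")
      case False
      then have "nmem t ''found'' 0 0 \<noteq> 0 \<and> rmem t ''bestD'' 0 0 \<le> dd a' b'"
        using that \<open>search_inv k N Q t\<close> by (auto simp: search_inv_def)
      then show ?thesis using True unfolding b by linarith
    qed simp
    ultimately show ?thesis
      using c best t(2) unfolding r search_inv_def by auto
  qed
qed

lemma run_search:
  assumes inv: "search_inv k N {} s" and pack: "packing_le N"
  shows "search_inv k N ({..<n} \<times> {..<n}) (run search s)"
proof -
  have sn: "nmem s ''n'' 0 0 = n" using inv by (auto simp: search_inv_def input_ok_n)
  show ?thesis
    unfolding search_def
  proof (rule For_rule[where I = "\<lambda>j t. search_inv k N ({..<j} \<times> {..<n}) t"], goal_cases)
    case (4 i t)
    have tn: "nmem t ''n'' 0 0 = n" using 4(5) by (auto simp: search_inv_def input_ok_n)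
    have "search_inv k N ({..<i} \<times> {..<n} \<union> {i} \<times> {..<n}) (run (For ''b'' attempt) t)"
    proof (rule For_rule[where I = "\<lambda>j u. search_inv k N ({..<i} \<times> {..<n} \<union> {i} \<times> {..<j}) u"], goal_cases)
      case (4 j u)
      have "nmem u ''a'' 0 0 = i" using 4(3)[of "''a''"] \<open>nmem t ''a'' 0 0 = i\<close> by simp
      from run_attempt[OF 4(5) this 4(2) \<open>i < n\<close> 4(1) pack]
      have "search_inv k N (insert (i, j) ({..<i} \<times> {..<n} \<union> {i} \<times> {..<j})) (run attempt u)" .
      moreover have "insert (i, j) ({..<i} \<times> {..<n} \<union> {i} \<times> {..<j}) = {..<i} \<times> {..<n} \<union> {i} \<times> {..<Suc j}"
        by (auto simp: less_Suc_eq)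
      ultimately show ?case by simp
    qed (use tn 4(5) in auto)
    moreover have "{..<i} \<times> {..<n} \<union> {i} \<times> {..<n} = {..<Suc i} \<times> {..<n}" by (auto simp: less_Suc_eq)
    ultimately show ?case by simp
  qed (use inv sn in auto)
qed

end

section \<open>Exactly \<open>k\<close> clusters and the output arrays\<close>

lemma run_old_roots:
  assumes "nmem s ''n'' 0 0 = n" "\<forall>x<n. arr s ''best'' x = l x"
  shows "\<forall>x<n. arr (run old_roots s) ''lab'' x = (if l x = Suc x then Suc x else 0)"
  unfolding old_roots_def
proof (rule For_rule[where I = "\<lambda>j t. \<forall>x<j. arr t ''lab'' x = (if l x = Suc x then Suc x else 0)"], goal_cases)
  case (4 j t)
  have "nmem t ''best'' j 0 = l j" using 4(1) 4(3)[of "''best''"] assms(2) by (simp add: arr_def)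
  then show ?case using 4(2,5) by (auto simp: less_Suc_eq arr_def upd_apply)
qed (use assms in auto)

lemma roots_upd:
  "x < n \<Longrightarrow> l x = 0 \<Longrightarrow> roots n (l(x := Suc x)) = insert x (roots n l) \<and> x \<notin> roots n l"
  by (auto simp: roots_def)

text \<open>The scan stops adding roots once there are \<open>k\<close>. If it never gets there, all
  \<open>n\<close> points have become roots, and \<open>k \<le> n\<close> forces equality in this
  case too.\<close>

lemma run_extra_roots:
  assumes "nmem s ''n'' 0 0 = n" "nmem s ''k'' 0 0 = k" "k \<le> n"
    and "nmem s ''cnt'' 0 0 = card (roots n (arr s ''lab''))" "card (roots n (arr s ''lab'')) \<le> k"
    and "\<forall>x<n. arr s ''lab'' x \<in> {0, Suc x}"
  shows "let l = arr (run extra_roots s) ''lab'' in (\<forall>x<n. l x \<in> {0, Suc x}) \<and>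
    roots n (arr s ''lab'') \<subseteq> roots n l \<and> card (roots n l) = k"
proof -
  let ?I = "\<lambda>j l c. (\<forall>x<n. l x \<in> {0, Suc x}) \<and> roots n (arr s ''lab'') \<subseteq> roots n l \<and>
    c = card (roots n l) \<and> c \<le> k \<and> (c = k \<or> (\<forall>x<j. l x \<noteq> 0))"
  have "?I n (arr (run extra_roots s) ''lab'') (nmem (run extra_roots s) ''cnt'' 0 0)"
    unfolding extra_roots_def
  proof (rule For_rule[where I = "\<lambda>j t. ?I j (arr t ''lab'') (nmem t ''cnt'' 0 0)"], goal_cases)
    case (4 j t)
    let ?l = "arr t ''lab''" and ?c = "nmem t ''cnt'' 0 0"
    let ?b = "BAnd (BNot (NonZero (Cell ''lab'' ''x''))) (NLess (Var ''cnt'') (Var ''k''))"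
    let ?t = "put ''x'' (Suc j) (run (When ?b
      (set_cell ''lab'' ''x'' (Next ''x'') ;; set_var ''cnt'' (Next ''cnt''))) t)"
    have k: "nmem t ''k'' 0 0 = k" using 4(3)[of "''k''"] assms by simp
    show ?case
    proof (cases "?l j = 0 \<and> ?c < k")
      case True
      then have eq: "arr ?t ''lab'' = ?l(j := Suc j)" "nmem ?t ''cnt'' 0 0 = Suc ?c"
        using k 4(2) by (auto simp: arr_def fun_eq_iff upd_apply)
      show ?thesis
        unfolding eq using 4(1,5) True roots_upd[of j n ?l] by (auto simp: less_Suc_eq)
    next
      case False
      then have eq: "arr ?t ''lab'' = ?l" "nmem ?t ''cnt'' 0 0 = ?c"
        using k 4(2) by (auto simp: arr_def)
      show ?thesis unfolding eq using 4(5) False by (auto simp: less_Suc_eq)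
    qed
  qed (use assms in auto)
  moreover have "roots n l = {..<n}" if "\<forall>x<n. l x \<in> {0, Suc x}" "\<forall>x<n. l x \<noteq> 0" for l :: "nat \<Rightarrow> nat"
    using that by (auto simp: roots_def)
  ultimately show ?thesis using \<open>k \<le> n\<close> unfolding Let_def
    by (metis card_lessThan le_antisym)
qed

text \<open>The number given to a root is its rank \<open>card (roots r l)\<close>, the count of
  smaller roots. This closed form replaces reasoning about the running counter in everything that
  follows.\<close>

lemma run_number_roots:
  assumes "nmem s ''n'' 0 0 = n"
  shows "\<forall>r\<in>roots n (arr s ''lab''). nmem (run number_roots s) ''num'' r 0 = card (roots r (arr s ''lab'')) \<and>
    nmem (run number_roots s) ''center'' (card (roots r (arr s ''lab''))) 0 = r"
proof -
  let ?l = "arr s ''lab''"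
  let ?I = "\<lambda>j t. nmem t ''cnt'' 0 0 = card (roots j ?l) \<and>
    (\<forall>r\<in>roots j ?l. nmem t ''num'' r 0 = card (roots r ?l) \<and> nmem t ''center'' (card (roots r ?l)) 0 = r)"
  let ?b = "NEq (Cell ''lab'' ''x'') (Next ''x'')"
  let ?p = "set_cell ''num'' ''x'' (Var ''cnt'') ;; set_cell ''center'' ''cnt'' (Var ''x'') ;;
        set_var ''cnt'' (Next ''cnt'')"
  let ?s = "s\<lparr>nmem := upd (nmem s) ''cnt'' 0 0 0\<rparr>"
  have "?I n (run (For ''x'' (When ?b ?p)) ?s)"
  proof (rule For_rule[where I = ?I], goal_cases)
    case (4 j t)
    have l: "nmem t ''lab'' j 0 = ?l j" using 4(3)[of "''lab''"] by (simp add: arr_def)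
    have new: "j \<notin> roots j ?l" by (simp add: roots_def)
    \<comment> \<open>Ranks increase strictly, so the entries written for earlier roots are not
      overwritten.\<close>
    have less: "card (roots r ?l) < card (roots j ?l)" "r < j" if "r \<in> roots j ?l" for r
    proof -
      show "r < j" using that by (simp add: roots_def)
      then have "roots r ?l \<subset> roots j ?l" using that by (auto simp: roots_def)
      then show "card (roots r ?l) < card (roots j ?l)" by (intro psubset_card_mono) auto
    qed
    show ?case
    proof (cases "?l j = Suc j")
      case False
      then show ?thesis using 4(2,5) l by (auto simp: roots_Suc)
    next
      case True
      then have "run (When ?b ?p) t = run ?p t" using l 4(2) by simp
      then show ?thesis using True 4(2,5) l new less
        by (auto simp: roots_Suc upd_apply dest: less_imp_neq)
    qed
  qed (use assms in \<open>auto simp: roots_def upd_apply\<close>)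
  then show ?thesis by (simp add: number_roots_def)
qed

lemma run_output_clusters:
  assumes "nmem s ''n'' 0 0 = n"
  shows "\<forall>x<n. nmem (run output_clusters s) ''cluster'' x 0 = nmem s ''num'' (arr s ''lab'' x - 1) 0"
  unfolding output_clusters_def
proof (rule For_rule[where I = "\<lambda>j t. \<forall>x<j. nmem t ''cluster'' x 0 = nmem s ''num'' (arr s ''lab'' x - 1) 0"],
    goal_cases)
  case (4 j t)
  have "nmem t ''lab'' j 0 = arr s ''lab'' j" "nmem t ''num'' = nmem s ''num''"
    using 4(3)[of "''lab''"] 4(3)[of "''num''"] by (simp_all add: arr_def)
  then show ?case using 4(2,5) by (auto simp: less_Suc_eq upd_apply)
qed (use assms in auto)

context index_metric
begin

lemma run_split:
  assumes s: "input_ok k s" and best: "\<forall>x<n. arr s ''best'' x = l x" and l: "good B k l" and "k \<le> n"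
  shows "let l' = arr (run split s) ''lab'' in rooted n e l' \<and> card (roots n l') = k \<and>
    (\<forall>x<n. l' x \<noteq> 0 \<and> l (l' x - 1) = l x)"
proof -
  define s1 s2 s3 s4 where "s1 = run old_roots s" and "s2 = run count s1"
    and "s3 = run extra_roots s2" and "s4 = run (table same_test) s3"
  have ok: "input_ok k s1" "input_ok k s2" "input_ok k s3" "input_ok k s4"
    using s by (auto simp: s1_def s2_def s3_def s4_def)
  have l1: "\<forall>x<n. arr s1 ''lab'' x = (if l x = Suc x then Suc x else 0)"
    unfolding s1_def by (rule run_old_roots) (use s best in \<open>auto simp: input_ok_n\<close>)
  then have roots1: "roots n (arr s1 ''lab'') = roots n l"
    by (auto simp: roots_def split: if_splits)
  have lab2: "arr s2 ''lab'' = arr s1 ''lab''" by (auto simp: s2_def run_frame intro: arr_cong)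
  have cnt2: "nmem s2 ''cnt'' 0 0 = card (roots n l)"
    using run_count[OF input_ok_n[OF ok(1)]] roots1 by (simp add: s2_def)
  have "let l = arr s3 ''lab'' in (\<forall>x<n. l x \<in> {0, Suc x}) \<and>
    roots n (arr s2 ''lab'') \<subseteq> roots n l \<and> card (roots n l) = k"
    unfolding s3_def
    by (rule run_extra_roots)
      (use ok(2) \<open>k \<le> n\<close> cnt2 lab2 roots1 l l1 in \<open>auto simp: input_ok_def good_def\<close>)
  then have l3: "\<forall>x<n. arr s3 ''lab'' x \<in> {0, Suc x}" "roots n l \<subseteq> roots n (arr s3 ''lab'')"
    "card (roots n (arr s3 ''lab'')) = k"
    using lab2 roots1 by (auto simp: Let_def)
  have lab4: "arr s4 ''lab'' = arr s3 ''lab''" by (auto simp: s4_def run_frame intro: arr_cong)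
  have best3: "nmem s3 ''best'' = nmem s ''best''"
    by (simp add: s1_def s2_def s3_def run_frame)
  have A: "\<forall>x<n. \<forall>y<n. nmem s4 ''A'' x y \<noteq> 0 \<longleftrightarrow> e x y \<and> l x = l y"
    unfolding s4_def
  proof (rule run_table)
    fix t :: store and x y
    assume xy: "x < n" "y < n" "nmem t ''x'' 0 0 = x" "nmem t ''y'' 0 0 = y"
      and fr: "\<And>a. a \<notin> {''x'', ''y'', ''A''} \<Longrightarrow> nmem t a = nmem s3 a"
    have "nmem t ''best'' x 0 = l x" "nmem t ''best'' y 0 = l y"
      using fr[of "''best''"] best3 best xy by (simp_all add: arr_def)
    then show "bval same_test t \<longleftrightarrow> e x y \<and> l x = l y"
      using xy fr[of "''E''"] ok(3) by (auto simp: same_test_def input_ok_def)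
  qed (use ok(3) in \<open>simp add: input_ok_n\<close>)
  have "propagated n (\<lambda>x y. e x y \<and> l x = l y) (arr s4 ''lab'') (arr (run propagate s4) ''lab'')"
    by (rule run_propagate) (use A ok(4) in \<open>auto simp: input_ok_n\<close>)
  moreover have "run split s = run propagate s4"
    by (simp add: split_def s1_def s2_def s3_def s4_def)
  ultimately show ?thesis
    using split_labelling[of n e l "arr s3 ''lab''" "arr (run split s) ''lab''"] l l3 lab4
    by (auto simp: good_def Let_def)
qed

text \<open>The factor 8 is twice the radius factor 4. \<open>N\<close> bounds the packing but does
  not influence the run.\<close>

lemma run_cluster_prog:
  assumes s: "input_ok k s" "\<forall>x\<ge>n. arr s ''lab'' x = 0" "nmem s ''found'' 0 0 = 0"
    and pack: "packing_le N" and ab: "a < n" "b < n" "feasible k (dd a b)" and "k \<le> n"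
  obtains l where "rooted n e l" "card (roots n l) = k" "\<And>x. x < n \<Longrightarrow> l x \<noteq> 0"
    "\<And>x y. \<lbrakk>x < n; y < n; l x = l y\<rbrakk> \<Longrightarrow> dd x y \<le> 8 * dd a b * real (Suc N)"
    "\<And>x. x < n \<Longrightarrow> nmem (run cluster_prog s) ''cluster'' x 0 = card (roots (l x - 1) l)"
    "\<And>r. r \<in> roots n l \<Longrightarrow> nmem (run cluster_prog s) ''center'' (card (roots r l)) 0 = r"
proof -
  define s1 s2 s3 where "s1 = run search s" and "s2 = run split s1" and "s3 = run number_roots s2"
  have ok: "input_ok k s1" "input_ok k s2" "input_ok k s3"
    using s by (auto simp: s1_def s2_def s3_def)
  have "search_inv k N {} s" using s by (simp add: search_inv_def)
  then have "search_inv k N ({..<n} \<times> {..<n}) s1" unfolding s1_def using pack by (rule run_search)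
  then obtain l\<^sub>0 where l\<^sub>0: "\<forall>x<n. arr s1 ''best'' x = l\<^sub>0 x" "good (4 * rmem s1 ''bestD'' 0 0 * real (Suc N)) k l\<^sub>0"
    and best: "rmem s1 ''bestD'' 0 0 \<le> dd a b"
    using ab unfolding search_inv_def by fastforce
  define l where "l = arr s2 ''lab''"
  have l: "rooted n e l" "card (roots n l) = k" "\<And>x. x < n \<Longrightarrow> l x \<noteq> 0"
    "\<And>x. x < n \<Longrightarrow> l\<^sub>0 (l x - 1) = l\<^sub>0 x"
    using run_split[OF ok(1) l\<^sub>0 \<open>k \<le> n\<close>] by (auto simp: Let_def l_def s2_def)
  have lab3: "arr s3 ''lab'' = l" by (auto simp: l_def s3_def run_frame intro: arr_cong)
  have num: "\<And>r. r \<in> roots n l \<Longrightarrow> nmem s3 ''num'' r 0 = card (roots r l) \<and>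
      nmem s3 ''center'' (card (roots r l)) 0 = r"
    using run_number_roots[OF input_ok_n[OF ok(2)]] by (simp add: l_def s3_def)
  have run: "run cluster_prog s = run output_clusters s3"
    by (simp add: cluster_prog_def s1_def s2_def s3_def)
  show ?thesis
  proof (rule that[OF l(1-3)])
    fix x y assume xy: "x < n" "y < n" "l x = l y"
    \<comment> \<open>The radius bound refers to the root before splitting; both points share it
      because splitting only refines the old clusters.\<close>
    let ?r = "l\<^sub>0 x - 1"
    have eq: "l\<^sub>0 y = l\<^sub>0 x" using l(4)[OF xy(1)] l(4)[OF xy(2)] xy(3) by simp
    have "?r < n" "dd x ?r \<le> 4 * rmem s1 ''bestD'' 0 0 * real (Suc N)"
      "dd y ?r \<le> 4 * rmem s1 ''bestD'' 0 0 * real (Suc N)"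
      using l\<^sub>0(2) xy eq unfolding good_def rooted_def radius_le_def by metis+
    then have "dd x y \<le> 8 * rmem s1 ''bestD'' 0 0 * real (Suc N)"
      using dd_triangle[of x ?r y] dd_sym[of y ?r] xy by simp
    also have "\<dots> \<le> 8 * dd a b * real (Suc N)"
      using best by (intro mult_right_mono mult_left_mono) auto
    finally show "dd x y \<le> 8 * dd a b * real (Suc N)" .
  next
    fix x assume x: "x < n"
    have "l x - 1 \<in> roots n l" using l(1) l(3)[OF x] x by (auto simp: rooted_def roots_def)
    then show "nmem (run cluster_prog s) ''cluster'' x 0 = card (roots (l x - 1) l)"
      using run_output_clusters[OF input_ok_n[OF ok(3)]] num x lab3 unfolding run by simp
  next
    fix r assume "r \<in> roots n l"
    then show "nmem (run cluster_prog s) ''center'' (card (roots r l)) 0 = r"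
      using num unfolding run by (simp add: run_frame)
  qed
qed

end

section \<open>Costs of clusterings\<close>

lemma connected_clustering_clusters:
  assumes "connected_clustering X E k C" "finite X" "i < k"
  shows "finite (C i)" "C i \<noteq> {}" "C i \<subseteq> X"
proof -
  show "C i \<subseteq> X" "C i \<noteq> {}" using assms by (auto simp: connected_clustering_def)
  then show "finite (C i)" using assms(2) finite_subset by blast
qed

lemma Max_image_attained:
  fixes f :: "'a \<Rightarrow> real"
  assumes "finite A" "A \<noteq> {}"
  obtains a where "a \<in> A" "Max (f ` A) = f a"
proof -
  have "Max (f ` A) \<in> f ` A" using assms by (intro Max_in) auto
  then show thesis by (elim imageE) (use that in blast)
qed

lemma Max_image_le:
  fixes f :: "'a \<Rightarrow> real"
  assumes "finite A" "A \<noteq> {}" "\<And>a. a \<in> A \<Longrightarrow> f a \<le> B"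
  shows "Max (f ` A) \<le> B"
  using assms by (simp add: Max_le_iff)

context
  fixes X :: "'a set" and d :: "'a \<Rightarrow> 'a \<Rightarrow> real" and E k C
  assumes clustering: "connected_clustering X E k C" and finite: "finite X" and k: "1 \<le> k"
begin

lemma indices_nonempty: "{..<k} \<noteq> {}"
  using k by (auto simp: lessThan_empty_iff)

lemma diameter_cost_le:
  assumes "\<And>i x y. \<lbrakk>i < k; x \<in> C i; y \<in> C i\<rbrakk> \<Longrightarrow> d x y \<le> B"
  shows "diameter_cost d k C \<le> B"
  unfolding diameter_cost_def
  by (intro Max_image_le)
    (simp_all add: indices_nonempty assms connected_clustering_clusters[OF clustering finite])

lemma center_cost_le:
  assumes "\<And>i x. \<lbrakk>i < k; x \<in> C i\<rbrakk> \<Longrightarrow> d x (c i) \<le> B"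
  shows "center_cost d k C c \<le> B"
  unfolding center_cost_def
  by (intro Max_image_le)
    (simp_all add: indices_nonempty assms connected_clustering_clusters[OF clustering finite])

lemma diameter_cost_ge:
  assumes "i < k" "x \<in> C i" "y \<in> C i"
  shows "d x y \<le> diameter_cost d k C"
proof -
  have fin: "finite (C i)" using connected_clustering_clusters[OF clustering finite assms(1)] by simp
  have "d x y \<le> (MAX y\<in>C i. d x y)" using fin assms by (intro Max_ge) auto
  also have "\<dots> \<le> (MAX x\<in>C i. MAX y\<in>C i. d x y)" using fin assms by (intro Max_ge) auto
  also have "\<dots> \<le> diameter_cost d k C"
    unfolding diameter_cost_def using assms by (intro Max_ge) auto
  finally show ?thesis .
qed

lemma center_cost_ge:
  assumes "i < k" "x \<in> C i"
  shows "d x (c i) \<le> center_cost d k C c"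
proof -
  have fin: "finite (C i)" using connected_clustering_clusters[OF clustering finite assms(1)] by simp
  have "d x (c i) \<le> (MAX x\<in>C i. d x (c i))" using fin assms by (intro Max_ge) auto
  also have "\<dots> \<le> center_cost d k C c"
    unfolding center_cost_def using assms by (intro Max_ge) auto
  finally show ?thesis .
qed

text \<open>The cost of a solution is a distance between two points, so the search over pairs meets
  the optimal diameter exactly, and the possible costs form a finite set.\<close>

lemma diameter_cost_attained:
  obtains x y where "x \<in> X" "y \<in> X" "diameter_cost d k C = d x y"
proof -
  note cl = connected_clustering_clusters[OF clustering finite]
  obtain i where i: "i \<in> {..<k}" "diameter_cost d k C = (MAX x\<in>C i. MAX y\<in>C i. d x y)"
    unfolding diameter_cost_def by (rule Max_image_attained[OF finite_lessThan indices_nonempty])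
  then have ik: "i < k" by simp
  obtain x where x: "x \<in> C i" "(MAX x\<in>C i. MAX y\<in>C i. d x y) = (MAX y\<in>C i. d x y)"
    using Max_image_attained[OF cl(1,2)[OF ik]] by blast
  obtain y where y: "y \<in> C i" "(MAX y\<in>C i. d x y) = d x y"
    using Max_image_attained[OF cl(1,2)[OF ik]] by blast
  show thesis using that[of x y] i x y cl(3)[OF ik] by auto
qed

lemma center_cost_attained:
  assumes "\<And>i. i < k \<Longrightarrow> c i \<in> C i"
  obtains x y where "x \<in> X" "y \<in> X" "center_cost d k C c = d x y"
proof -
  note cl = connected_clustering_clusters[OF clustering finite]
  obtain i where i: "i \<in> {..<k}" "center_cost d k C c = (MAX x\<in>C i. d x (c i))"
    unfolding center_cost_def by (rule Max_image_attained[OF finite_lessThan indices_nonempty])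
  then have ik: "i < k" by simp
  obtain x where x: "x \<in> C i" "(MAX x\<in>C i. d x (c i)) = d x (c i)"
    using Max_image_attained[OF cl(1,2)[OF ik]] by blast
  show thesis using that[of x "c i"] i x assms[OF ik] cl(3)[OF ik] by auto
qed

text \<open>Representatives of disjoint nonempty clusters are distinct. This guarantees enough
  points for the extra roots.\<close>

lemma clusters_le_card: "k \<le> card X"
proof -
  note cl = connected_clustering_clusters[OF clustering finite]
  define r where "r i = (SOME x. x \<in> C i)" for i
  have r: "r i \<in> C i" if "i < k" for i
    using cl(2)[OF that] by (auto simp: r_def some_in_eq)
  have "inj_on r {..<k}"
  proof (rule inj_onI)
    fix i j assume ij: "i \<in> {..<k}" "j \<in> {..<k}" "r i = r j"
    then have "r i \<in> C i \<inter> C j" using r[of i] r[of j] by auto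
    then show "i = j"
      using clustering ij unfolding connected_clustering_def disjoint_family_on_def by blast
  qed
  moreover have "r ` {..<k} \<subseteq> X" using r cl(3) by blast
  ultimately show ?thesis using card_inj_on_le[of r "{..<k}" X] finite by simp
qed

end

text \<open>The values of \<open>C\<close> beyond \<open>k\<close> are arbitrary, so there are
  infinitely many feasible \<open>C\<close>. Their costs are distances between points of the finite
  \<open>X\<close>, hence \<open>Min\<close> is a genuine minimum.\<close>

lemma diameter_opt_attained:
  assumes "finite X" "1 \<le> k" "connected_clustering X E k C\<^sub>0"
  obtains C where "connected_clustering X E k C" "diameter_cost d k C = diameter_opt X d E k"
proof -
  let ?S = "{diameter_cost d k C |C. connected_clustering X E k C}"
  have "?S \<subseteq> (\<lambda>(x, y). d x y) ` (X \<times> X)"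
  proof
    fix z assume "z \<in> ?S"
    then obtain C where C: "connected_clustering X E k C" "z = diameter_cost d k C" by auto
    obtain x y where "x \<in> X" "y \<in> X" "diameter_cost d k C = d x y"
      by (rule diameter_cost_attained[OF C(1) assms(1,2)])
    then show "z \<in> (\<lambda>(x, y). d x y) ` (X \<times> X)"
      unfolding C(2) by (intro image_eqI[of _ _ "(x, y)"]) auto
  qed
  then have "finite ?S" using assms(1) by (meson finite_SigmaI finite_imageI finite_subset)
  moreover have "?S \<noteq> {}" using assms(3) by auto
  ultimately have "diameter_opt X d E k \<in> ?S" unfolding diameter_opt_def by (rule Min_in)
  then show thesis using that by auto
qed

lemma center_opt_attained:
  assumes "finite X" "1 \<le> k" "connected_center_clustering X E k C\<^sub>0 c\<^sub>0"
  obtains C c where "connected_center_clustering X E k C c" "center_cost d k C c = center_opt X d E k"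
proof -
  let ?S = "{center_cost d k C c |C c. connected_center_clustering X E k C c}"
  have "?S \<subseteq> (\<lambda>(x, y). d x y) ` (X \<times> X)"
  proof
    fix z assume "z \<in> ?S"
    then obtain C c where C: "connected_clustering X E k C" "z = center_cost d k C c" "\<forall>i<k. c i \<in> C i"
      by (auto simp: connected_center_clustering_def)
    obtain x y where "x \<in> X" "y \<in> X" "center_cost d k C c = d x y"
      by (rule center_cost_attained[OF C(1) assms(1,2), of c]) (use C(3) in auto)
    then show "z \<in> (\<lambda>(x, y). d x y) ` (X \<times> X)"
      unfolding C(2) by (intro image_eqI[of _ _ "(x, y)"]) auto
  qed
  then have "finite ?S" using assms(1) by (meson finite_SigmaI finite_imageI finite_subset)
  moreover have "?S \<noteq> {}" using assms(3) by auto
  ultimately have "center_opt X d E k \<in> ?S" unfolding center_opt_def by (rule Min_in)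
  then show thesis using that by auto
qed

section \<open>Doubling metrics\<close>

context Metric_space
begin

text \<open>In a finite space the balls around all points form a cover of bounded size, so the set
  under \<open>LEAST\<close> is nonempty and the least value has the covering property.\<close>

lemma doubling_cover:
  assumes "finite M" "x \<in> M" "0 < \<rho>"
  shows "\<exists>S\<subseteq>M. finite S \<and> card S \<le> doubling_constant M d \<and> mcball x \<rho> \<subseteq> (\<Union>s\<in>S. mcball s (\<rho> / 2))"
proof -
  let ?P = "\<lambda>K. \<forall>x\<in>M. \<forall>\<rho>>0. \<exists>S\<subseteq>M. finite S \<and> card S \<le> K \<and> mcball x \<rho> \<subseteq> (\<Union>s\<in>S. mcball s (\<rho> / 2))"
  have "?P (card M)"
  proof (intro ballI allI impI exI[of _ M] conjI)
    fix x \<rho> assume "x \<in> M" "0 < (\<rho> :: real)"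
    then show "mcball x \<rho> \<subseteq> (\<Union>s\<in>M. mcball s (\<rho> / 2))"
      by (force simp: in_mcball)
  qed (use assms(1) in auto)
  then have "?P (doubling_constant M d)"
    unfolding doubling_constant_def by (rule LeastI)
  then show ?thesis using assms by blast
qed

lemma doubling_cover_power:
  assumes "finite M" "x \<in> M" "0 < \<rho>"
  shows "\<exists>S\<subseteq>M. finite S \<and> card S \<le> doubling_constant M d ^ m \<and> mcball x \<rho> \<subseteq> (\<Union>s\<in>S. mcball s (\<rho> / 2 ^ m))"
proof (induction m)
  case 0
  show ?case using assms by (intro exI[of _ "{x}"]) auto
next
  case (Suc m)
  let ?K = "doubling_constant M d"
  obtain S where S: "S \<subseteq> M" "finite S" "card S \<le> ?K ^ m" "mcball x \<rho> \<subseteq> (\<Union>s\<in>S. mcball s (\<rho> / 2 ^ m))"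
    using Suc by auto
  have "\<forall>s\<in>S. \<exists>T\<subseteq>M. finite T \<and> card T \<le> ?K \<and> mcball s (\<rho> / 2 ^ m) \<subseteq> (\<Union>t\<in>T. mcball t (\<rho> / 2 ^ m / 2))"
  proof
    fix s assume "s \<in> S"
    then have "s \<in> M" using S(1) by blast
    from doubling_cover[OF assms(1) this, of "\<rho> / 2 ^ m"] assms(3)
    show "\<exists>T\<subseteq>M. finite T \<and> card T \<le> ?K \<and> mcball s (\<rho> / 2 ^ m) \<subseteq> (\<Union>t\<in>T. mcball t (\<rho> / 2 ^ m / 2))"
      by simp
  qed
  then obtain T where T: "\<And>s. s \<in> S \<Longrightarrow> T s \<subseteq> M \<and> finite (T s) \<and> card (T s) \<le> ?K \<and>
      mcball s (\<rho> / 2 ^ m) \<subseteq> (\<Union>t\<in>T s. mcball t (\<rho> / 2 ^ m / 2))"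
    by metis
  have "card (\<Union>s\<in>S. T s) \<le> (\<Sum>s\<in>S. card (T s))" using S(2) by (rule card_UN_le)
  also have "\<dots> \<le> card S * ?K" using T sum_bounded_above[of S "\<lambda>s. card (T s)" ?K] by simp
  also have "\<dots> \<le> ?K ^ m * ?K" using S(3) by (rule mult_right_mono) simp
  finally have "card (\<Union>s\<in>S. T s) \<le> ?K ^ Suc m" by (simp add: mult.commute)
  moreover have "mcball x \<rho> \<subseteq> (\<Union>t\<in>(\<Union>s\<in>S. T s). mcball t (\<rho> / 2 ^ Suc m))"
  proof
    fix y assume "y \<in> mcball x \<rho>"
    then obtain s where "s \<in> S" "y \<in> mcball s (\<rho> / 2 ^ m)" using S(4) by blast
    then obtain t where "t \<in> T s" "y \<in> mcball t (\<rho> / 2 ^ m / 2)" using T by blast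
    then show "y \<in> (\<Union>t\<in>(\<Union>s\<in>S. T s). mcball t (\<rho> / 2 ^ Suc m))"
      using \<open>s \<in> S\<close> by (auto simp: mult.commute)
  qed
  ultimately show ?case using S(2) T by (intro exI[of _ "\<Union>s\<in>S. T s"]) auto
qed

lemma doubling_constant_pos:
  assumes "finite M" "x \<in> M"
  shows "0 < doubling_constant M d"
proof -
  obtain S where S: "finite S" "card S \<le> doubling_constant M d" "mcball x 1 \<subseteq> (\<Union>s\<in>S. mcball s (1 / 2))"
    using doubling_cover[OF assms, of 1] by auto
  moreover have "x \<in> mcball x 1" using assms by simp
  ultimately have "S \<noteq> {}" by blast
  then show ?thesis using S by (metis card_gt_0_iff le_zero_eq not_gr_zero)
qed

lemma doubling_constant_le_dim:
  assumes "finite M" "x \<in> M"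
  shows "doubling_constant M d \<le> 2 ^ doubling_dim M d"
proof -
  let ?K = "real (doubling_constant M d)"
  have K: "1 \<le> ?K" using doubling_constant_pos[OF assms] by simp
  have "?K = 2 powr log 2 ?K" using K by simp
  also have "\<dots> \<le> 2 powr real (doubling_dim M d)"
    unfolding doubling_dim_def by (intro powr_mono) (use real_nat_ceiling_ge in auto)
  also have "\<dots> = 2 ^ doubling_dim M d" by (simp add: powr_realpow)
  finally have "?K \<le> real (2 ^ doubling_dim M d)" by simp
  then show ?thesis by (simp only: of_nat_le_iff)
qed

end

section \<open>The approximation guarantee\<close>

locale clustering_input =
  fixes xs :: "'a list" and d :: "'a \<Rightarrow> 'a \<Rightarrow> real" and E :: "('a \<times> 'a) set" and k :: nat
  assumes inst: "clustering_instance (set xs) d E k" and dist: "distinct xs"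
begin

sublocale Metric_space "set xs" d
  using inst by (simp add: clustering_instance_def)

sublocale index_metric "length xs" "\<lambda>i j. d (xs ! i) (xs ! j)" "\<lambda>i j. (xs ! i, xs ! j) \<in> E"
  by unfold_locales (auto simp: commute triangle)

abbreviation final :: store where
  "final \<equiv> run cluster_prog (encode xs d E k)"

text \<open>16 is twice the 8 of the diameter bound, the doubling being due to
  \<open>Suc (K ^ 3) \<le> 2 * K ^ 3\<close> for the doubling constant \<open>K\<close>.\<close>

abbreviation factor :: real where
  "factor \<equiv> 16 * 2 ^ (3 * doubling_dim (set xs) d)"

lemma k_pos: "1 \<le> k"
  using inst by (simp add: clustering_instance_def)

text \<open>Three halvings turn \<open>4 * D\<close> into \<open>D / 2\<close>. A ball of that
  radius has diameter at most \<open>D\<close> and so contains at most one point of a separated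
  set.\<close>

lemma packing: "packing_le (doubling_constant (set xs) d ^ 3)"
  unfolding packing_le_def
proof (intro allI impI)
  let ?K = "doubling_constant (set xs) d"
  fix D u S
  assume D: "0 \<le> (D :: real)" and u: "u < length xs"
    and S: "separated D S \<and> (\<forall>s\<in>S. d (xs ! u) (xs ! s) \<le> 4 * D)"
  have Sn: "S \<subseteq> {..<length xs}" using S by (simp add: separated_def)
  show "card S \<le> ?K ^ 3"
  proof (cases "D = 0")
    \<comment> \<open>Doubling covers exist for positive radii only. At radius 0 the ball is a
      single point, and the bound follows from the doubling constant being positive.\<close>
    case True
    have "S \<subseteq> {u}"
    proof
      fix s assume s: "s \<in> S"
      then have "d (xs ! u) (xs ! s) \<le> 4 * D" using S by blast
      then have "d (xs ! u) (xs ! s) = 0" using True nonneg[of "xs ! u" "xs ! s"] by simp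
      then have "xs ! u = xs ! s" using zero u s Sn by auto
      then show "s \<in> {u}" using nth_eq_iff_index_eq[OF dist u] s Sn by auto
    qed
    then have "card S \<le> card {u}" by (intro card_mono) auto
    also have "\<dots> \<le> ?K ^ 3"
      using doubling_constant_pos[of "xs ! u"] u by simp
    finally show ?thesis .
  next
    case False
    with D have "0 < 4 * D" by simp
    then obtain T where T: "finite T" "card T \<le> ?K ^ 3"
      "mcball (xs ! u) (4 * D) \<subseteq> (\<Union>t\<in>T. mcball t (4 * D / 2 ^ 3))"
      using doubling_cover_power[of "xs ! u" "4 * D" 3] u by auto
    have "\<exists>t\<in>T. xs ! s \<in> mcball t (D / 2)" if "s \<in> S" for s
    proof -
      have "xs ! s \<in> mcball (xs ! u) (4 * D)" using that S Sn u by (auto simp: in_mcball)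
      then have "xs ! s \<in> (\<Union>t\<in>T. mcball t (4 * D / 2 ^ 3))" using T(3) by (rule subsetD[rotated])
      then show ?thesis by simp
    qed
    then obtain f where f: "\<And>s. s \<in> S \<Longrightarrow> f s \<in> T \<and> xs ! s \<in> mcball (f s) (D / 2)" by metis
    have "inj_on f S"
    proof (rule inj_onI, rule ccontr)
      fix s t assume st: "s \<in> S" "t \<in> S" "f s = f t" "s \<noteq> t"
      have "xs ! s \<in> mcball (f s) (D / 2)" "xs ! t \<in> mcball (f s) (D / 2)" using f st by metis+
      then have "d (xs ! s) (xs ! t) \<le> D"
        using triangle[of "xs ! s" "f s" "xs ! t"] commute[of "xs ! s" "f s"] by auto
      then show False using S st unfolding separated_def by force
    qed
    then have "card S \<le> card T" using f T(1) by (intro card_inj_on_le[of f]) auto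
    then show ?thesis using T(2) by simp
  qed
qed

text \<open>Transports a path inside a cluster from points to indices, which is unambiguous because
  the enumeration is distinct.\<close>

lemma class_rel_Restr:
  assumes "(a, b) \<in> (Restr E (C c))\<^sup>*" "a = xs ! i" "i < length xs" "j < length xs" "b = xs ! j"
    and p: "\<And>j. j < length xs \<Longrightarrow> xs ! j \<in> C c \<Longrightarrow> p j = c" and "C c \<subseteq> set xs"
  shows "(i, j) \<in> (class_rel (length xs) (\<lambda>i j. (xs ! i, xs ! j) \<in> E) p c)\<^sup>*"
proof -
  have "\<forall>j<length xs. xs ! j = b \<longrightarrow> (i, j) \<in> (class_rel (length xs) (\<lambda>i j. (xs ! i, xs ! j) \<in> E) p c)\<^sup>*"
    using assms(1)
  proof (induction rule: rtrancl_induct)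
    case base
    then show ?case using nth_eq_iff_index_eq[OF dist] assms(2,3) by auto
  next
    case (step y z)
    then have yz: "(y, z) \<in> E" "y \<in> C c" "z \<in> C c" by auto
    then obtain m where m: "m < length xs" "xs ! m = y"
      using assms(7) by (metis in_set_conv_nth subsetD)
    show ?case
    proof (intro allI impI)
      fix j assume j: "j < length xs" "xs ! j = z"
      have "(m, j) \<in> class_rel (length xs) (\<lambda>i j. (xs ! i, xs ! j) \<in> E) p c"
        using m j yz p by (auto simp: class_rel_def)
      moreover have "(i, m) \<in> (class_rel (length xs) (\<lambda>i j. (xs ! i, xs ! j) \<in> E) p c)\<^sup>*"
        using step.IH m by blast
      ultimately show "(i, j) \<in> (class_rel (length xs) (\<lambda>i j. (xs ! i, xs ! j) \<in> E) p c)\<^sup>*"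
        by (rule rtrancl.rtrancl_into_rtrancl[rotated])
    qed
  qed
  then show ?thesis using assms(4,5) by simp
qed

lemma feasible_clustering:
  assumes C: "connected_clustering (set xs) E k C"
  shows "feasible k (diameter_cost d k C)"
proof -
  have cover: "(\<Union>i<k. C i) = set xs" and disj: "disjoint_family_on C {..<k}"
    and conn: "\<And>i. i < k \<Longrightarrow> induces_connected E (C i)"
    using C by (auto simp: connected_clustering_def)
  \<comment> \<open>Cluster numbers serve as class names; disjointness makes the description
    definite.\<close>
  define p where "p j = (THE i. i < k \<and> xs ! j \<in> C i)" for j
  have uniq: "p j = i" if "i < k" "xs ! j \<in> C i" for i j
    unfolding p_def
    using that disj unfolding disjoint_family_on_def by (intro the_equality) auto
  have p: "p j < k" "xs ! j \<in> C (p j)" if "j < length xs" for j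
  proof -
    have "xs ! j \<in> (\<Union>i<k. C i)" unfolding cover using that by simp
    then obtain i where "i < k" "xs ! j \<in> C i" by auto
    then show "p j < k" "xs ! j \<in> C (p j)" using uniq by auto
  qed
  have "partition_diam (diameter_cost d k C) p"
    unfolding partition_diam_def
  proof (intro allI impI conjI)
    fix x y assume xy: "x < length xs" "y < length xs" "p x = p y"
    have mem: "xs ! x \<in> C (p x)" "xs ! y \<in> C (p x)" "p x < k"
      using p[OF xy(1)] p[OF xy(2)] xy(3) by simp_all
    show "d (xs ! x) (xs ! y) \<le> diameter_cost d k C"
      by (rule diameter_cost_ge[OF C _ k_pos mem(3,1,2)]) simp
    have "(xs ! x, xs ! y) \<in> (Restr E (C (p x)))\<^sup>*"
      using conn[OF mem(3)] mem by (simp add: induces_connected_def)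
    then show "(x, y) \<in> (class_rel (length xs) (\<lambda>i j. (xs ! i, xs ! j) \<in> E) p (p x))\<^sup>*"
      by (rule class_rel_Restr) (use xy uniq mem(3) cover in auto)
  qed
  then show ?thesis using p unfolding feasible_def by blast
qed

lemma diameter_cost_index:
  assumes C: "connected_clustering (set xs) E k C"
  obtains a b where "a < length xs" "b < length xs" "diameter_cost d k C = d (xs ! a) (xs ! b)"
proof -
  obtain x y where xy: "x \<in> set xs" "y \<in> set xs" "diameter_cost d k C = d x y"
    by (rule diameter_cost_attained[OF C _ k_pos]) auto
  then show thesis using that by (auto simp: in_set_conv_nth)
qed

lemma factor_bound:
  assumes "0 \<le> D" "x \<in> set xs"
  shows "8 * D * real (Suc (doubling_constant (set xs) d ^ 3)) \<le> factor * D"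
proof -
  let ?K = "doubling_constant (set xs) d"
  have "1 \<le> ?K ^ 3" using doubling_constant_pos[OF _ assms(2)] by (simp add: Suc_leI)
  then have "Suc (?K ^ 3) \<le> 2 * ?K ^ 3" by simp
  also have "\<dots> \<le> 2 * (2 ^ doubling_dim (set xs) d) ^ 3"
    using doubling_constant_le_dim[OF _ assms(2)] by (intro mult_left_mono power_mono) auto
  also have "\<dots> = 2 * 2 ^ (3 * doubling_dim (set xs) d)"
    by (simp add: power_mult[symmetric] mult.commute)
  finally have "real (Suc (?K ^ 3)) \<le> real (2 * 2 ^ (3 * doubling_dim (set xs) d))"
    by (simp only: of_nat_le_iff)
  then have "8 * D * real (Suc (?K ^ 3)) \<le> 8 * D * real (2 * 2 ^ (3 * doubling_dim (set xs) d))"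
    using assms(1) by (intro mult_left_mono) auto
  then show ?thesis by (simp add: mult_ac)
qed

text \<open>Ranks grow strictly along the roots, so they are distinct, and by counting they exhaust
  the range.\<close>

lemma rank_bij:
  "bij_betw (\<lambda>r. card (roots r l)) (roots n l) {..<card (roots n l)}"
proof -
  have less: "card (roots r l) < card (roots m l)" if "r \<in> roots m l" for r m
  proof -
    have "roots r l \<subset> roots m l" using that by (auto simp: roots_def)
    then show ?thesis by (intro psubset_card_mono) auto
  qed
  have "inj_on (\<lambda>r. card (roots r l)) (roots n l)"
  proof (rule linorder_inj_onI)
    fix r q assume "r < q" "r \<in> roots n l" "q \<in> roots n l"
    then have "r \<in> roots q l" by (auto simp: roots_def)
    then show "card (roots r l) \<noteq> card (roots q l)" using less by force
  qed auto
  moreover have "(\<lambda>r. card (roots r l)) ` roots n l \<subseteq> {..<card (roots n l)}" using less by auto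
  ultimately show ?thesis
    by (metis bij_betw_def card_image card_lessThan card_subset_eq finite_lessThan)
qed

lemma run_encode:
  assumes C: "connected_clustering (set xs) E k C"
  shows "connected_clustering (set xs) E k (out_clusters xs final)"
    and "\<And>i. i < k \<Longrightarrow> nmem final ''center'' i 0 < length xs \<and>
      out_centers xs final i \<in> out_clusters xs final i"
    and "\<And>i x y. \<lbrakk>i < k; x \<in> out_clusters xs final i; y \<in> out_clusters xs final i\<rbrakk>
      \<Longrightarrow> d x y \<le> factor * diameter_cost d k C"
proof -
  let ?n = "length xs" and ?s = "encode xs d E k"
  obtain a b where ab: "a < ?n" "b < ?n" "diameter_cost d k C = d (xs ! a) (xs ! b)"
    by (rule diameter_cost_index[OF C])
  have ok: "input_ok k ?s" "\<forall>x\<ge>?n. arr ?s ''lab'' x = 0" "nmem ?s ''found'' 0 0 = 0"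
    by (auto simp: input_ok_def encode_def arr_def)
  have feas: "feasible k (d (xs ! a) (xs ! b))" using feasible_clustering[OF C] ab(3) by simp
  have kn: "k \<le> ?n" using clusters_le_card[OF C _ k_pos] distinct_card[OF dist] by simp
  obtain l where l: "rooted ?n (\<lambda>i j. (xs ! i, xs ! j) \<in> E) l" "card (roots ?n l) = k"
    "\<And>x. x < ?n \<Longrightarrow> l x \<noteq> 0"
    "\<And>x y. \<lbrakk>x < ?n; y < ?n; l x = l y\<rbrakk> \<Longrightarrow>
      d (xs ! x) (xs ! y) \<le> 8 * d (xs ! a) (xs ! b) * real (Suc (doubling_constant (set xs) d ^ 3))"
    "\<And>x. x < ?n \<Longrightarrow> nmem final ''cluster'' x 0 = card (roots (l x - 1) l)"
    "\<And>r. r \<in> roots ?n l \<Longrightarrow> nmem final ''center'' (card (roots r l)) 0 = r"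
    by (rule run_cluster_prog[OF ok packing ab(1,2) feas kn]) (rule that; blast)
  let ?rank = "\<lambda>r. card (roots r l)"
  have bij: "bij_betw ?rank (roots ?n l) {..<k}" using rank_bij[of l ?n] l(2) by simp
  have root: "l x - 1 \<in> roots ?n l" if "x < ?n" for x
    using l(1) l(3)[OF that] that by (auto simp: rooted_def roots_def)
  have cluster: "out_clusters xs final (?rank r) = {xs ! j |j. j < ?n \<and> l j = Suc r}"
    if r: "r \<in> roots ?n l" for r
  proof -
    \<comment> \<open>Ranks are injective on roots, so equal cluster numbers mean equal
      labels.\<close>
    have "nmem final ''cluster'' j 0 = ?rank r \<longleftrightarrow> l j = Suc r" if "j < ?n" for j
      using inj_on_eq_iff[OF bij_betw_imp_inj_on[OF bij] root[OF that] r] l(5)[OF that] l(3)[OF that]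
      by (simp only:) arith
    then show ?thesis unfolding out_clusters_def by blast
  qed
  have ex_root: "\<exists>r\<in>roots ?n l. i = ?rank r" if "i < k" for i
    using bij that by (auto simp: bij_betw_def)
  have conn: "induces_connected E (out_clusters xs final (?rank r))" if r: "r \<in> roots ?n l" for r
  proof -
    let ?Q = "Restr E (out_clusters xs final (?rank r))"
    have path: "(xs ! r, xs ! j) \<in> ?Q\<^sup>*" if j: "j < ?n" "l j = Suc r" for j
    proof -
      have "(l j - 1, j) \<in> (class_rel ?n (\<lambda>i j. (xs ! i, xs ! j) \<in> E) l (l j))\<^sup>*"
        using l(1) l(3)[OF j(1)] j(1) unfolding rooted_def by blast
      then have "(r, j) \<in> (class_rel ?n (\<lambda>i j. (xs ! i, xs ! j) \<in> E) l (Suc r))\<^sup>*"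
        using j(2) by simp
      then show ?thesis
      proof (induction rule: rtrancl_induct)
        case (step u v)
        then have "(xs ! u, xs ! v) \<in> ?Q"
          using cluster[OF r] by (auto simp: class_rel_def)
        then show ?case using step.IH by (rule rtrancl.rtrancl_into_rtrancl[rotated])
      qed simp
    qed
    have "sym E" using inst by (simp add: clustering_instance_def)
    \<comment> \<open>Paths from the root become paths between any two members by reversing one of
      them.\<close>
    then have "sym (?Q\<^sup>*)" by (intro sym_rtrancl) (auto simp: sym_def)
    show ?thesis
      unfolding induces_connected_def
    proof (intro ballI)
      fix x y assume "x \<in> out_clusters xs final (?rank r)" "y \<in> out_clusters xs final (?rank r)"
      then have "(xs ! r, x) \<in> ?Q\<^sup>*" "(xs ! r, y) \<in> ?Q\<^sup>*"
        using path cluster[OF r] by auto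
      then show "(x, y) \<in> ?Q\<^sup>*" using \<open>sym (?Q\<^sup>*)\<close> by (meson rtrancl_trans symD)
    qed
  qed
  have center: "nmem final ''center'' (?rank r) 0 < ?n \<and>
      out_centers xs final (?rank r) \<in> out_clusters xs final (?rank r)" if r: "r \<in> roots ?n l" for r
    using r l(6)[OF r] cluster[OF r] by (auto simp: out_centers_def roots_def)
  show "connected_clustering (set xs) E k (out_clusters xs final)"
    unfolding connected_clustering_def
  proof (intro conjI allI impI)
    show "(\<Union>i<k. out_clusters xs final i) = set xs"
    proof
      show "set xs \<subseteq> (\<Union>i<k. out_clusters xs final i)"
      proof
        fix x assume "x \<in> set xs"
        then obtain j where j: "j < ?n" "x = xs ! j" by (auto simp: in_set_conv_nth)
        have "x \<in> out_clusters xs final (?rank (l j - 1))"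
          unfolding cluster[OF root[OF j(1)]] using j l(3)[OF j(1)] by auto
        moreover have "?rank (l j - 1) < k" using bij root[OF j(1)] by (auto simp: bij_betw_def)
        ultimately show "x \<in> (\<Union>i<k. out_clusters xs final i)" by blast
      qed
    qed (auto simp: out_clusters_def)
    show "disjoint_family_on (out_clusters xs final) {..<k}"
      using nth_eq_iff_index_eq[OF dist] by (auto simp: disjoint_family_on_def out_clusters_def)
    fix i assume "i < k"
    then obtain r where "r \<in> roots ?n l" "i = ?rank r" using ex_root by blast
    then show "out_clusters xs final i \<noteq> {}" "induces_connected E (out_clusters xs final i)"
      using center conn by auto
  qed
  show "nmem final ''center'' i 0 < ?n \<and> out_centers xs final i \<in> out_clusters xs final i"
    if "i < k" for i
    using ex_root[OF that] center by blast
  fix i x y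
  assume i: "i < k" and xy: "x \<in> out_clusters xs final i" "y \<in> out_clusters xs final i"
  obtain r where r: "r \<in> roots ?n l" "i = ?rank r" using ex_root[OF i] by blast
  obtain u v where uv: "u < ?n" "v < ?n" "l u = l v" "x = xs ! u" "y = xs ! v"
    using xy unfolding r(2) cluster[OF r(1)] by auto
  have "d x y \<le> 8 * diameter_cost d k C * real (Suc (doubling_constant (set xs) d ^ 3))"
    using l(4)[OF uv(1-3)] uv ab(3) by simp
  also have "\<dots> \<le> factor * diameter_cost d k C"
    by (rule factor_bound[of _ "xs ! u"]) (use uv ab in auto)
  finally show "d x y \<le> factor * diameter_cost d k C" .
qed

lemma run_time:
  "\<exists>t. exec (compile cluster_prog) (encode xs d E k) t final \<and> t \<le> poly (cost cluster_prog) (card (set xs))"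
proof -
  have "nmem (encode xs d E k) ''n'' 0 0 = card (set xs)"
    using distinct_card[OF dist] by (simp add: encode_def)
  then show ?thesis using exec_compile[of cluster_prog "encode xs d E k"] by simp
qed

lemma approximates_diameter:
  "approximates_diameter (compile cluster_prog) factor (poly (cost cluster_prog) (card (set xs))) xs d E k"
proof -
  have "connected_clustering (set xs) E k (out_clusters xs final) \<and>
      diameter_cost d k (out_clusters xs final) \<le> factor * diameter_opt (set xs) d E k"
    if feas: "connected_clustering (set xs) E k C\<^sub>0" for C\<^sub>0
  proof -
    obtain C where C: "connected_clustering (set xs) E k C" "diameter_cost d k C = diameter_opt (set xs) d E k"
      by (rule diameter_opt_attained[OF _ k_pos feas]) auto
    note out = run_encode[OF C(1)]
    have "diameter_cost d k (out_clusters xs final) \<le> factor * diameter_cost d k C"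
      by (rule diameter_cost_le[OF out(1) _ k_pos out(3)]) auto
    then show ?thesis using out(1) C(2) by simp
  qed
  then show ?thesis using run_time unfolding approximates_diameter_def by blast
qed

text \<open>The factor 2 is lost on the side of the optimum, whose clusters have diameter at most
  twice their radius. On the output side nothing is lost: whichever member of a cluster is its
  centre, its distance to the others is at most the diameter.\<close>

lemma approximates_center:
  "approximates_center (compile cluster_prog) (2 * factor) (poly (cost cluster_prog) (card (set xs))) xs d E k"
proof -
  have "(\<forall>i<k. nmem final ''center'' i 0 < length xs) \<and>
      connected_center_clustering (set xs) E k (out_clusters xs final) (out_centers xs final) \<and>
      center_cost d k (out_clusters xs final) (out_centers xs final) \<le> 2 * factor * center_opt (set xs) d E k"
    if feas: "connected_center_clustering (set xs) E k C\<^sub>0 c\<^sub>0" for C\<^sub>0 c\<^sub>0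
  proof -
    obtain C c where C: "connected_center_clustering (set xs) E k C c"
      "center_cost d k C c = center_opt (set xs) d E k"
      by (rule center_opt_attained[OF _ k_pos feas]) auto
    then have cl: "connected_clustering (set xs) E k C" and c: "\<And>i. i < k \<Longrightarrow> c i \<in> C i"
      by (auto simp: connected_center_clustering_def)
    note out = run_encode[OF cl]
    have "diameter_cost d k C \<le> 2 * center_cost d k C c"
    proof (rule diameter_cost_le[OF cl _ k_pos])
      fix i x y assume i: "i < k" and xy: "x \<in> C i" "y \<in> C i"
      have "x \<in> set xs" "y \<in> set xs" "c i \<in> set xs"
        using connected_clustering_clusters(3)[OF cl _ i] xy c[OF i] by auto
      then have "d x y \<le> d x (c i) + d y (c i)"
        using triangle[of x "c i" y] commute[of y "c i"] by simp
      also have "\<dots> \<le> 2 * center_cost d k C c"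
        using center_cost_ge[OF cl _ k_pos i xy(1), of d c] center_cost_ge[OF cl _ k_pos i xy(2), of d c]
        by simp
      finally show "d x y \<le> 2 * center_cost d k C c" .
    qed simp
    then have "factor * diameter_cost d k C \<le> factor * (2 * center_cost d k C c)"
      by (intro mult_left_mono) auto
    also have "\<dots> = 2 * factor * center_opt (set xs) d E k" using C(2) by simp
    finally have "factor * diameter_cost d k C \<le> 2 * factor * center_opt (set xs) d E k" .
    moreover have "center_cost d k (out_clusters xs final) (out_centers xs final) \<le> factor * diameter_cost d k C"
      by (rule center_cost_le[OF out(1) _ k_pos]) (use out(2,3) in auto)
    ultimately have "center_cost d k (out_clusters xs final) (out_centers xs final)
        \<le> 2 * factor * center_opt (set xs) d E k"
      by (rule order_trans[rotated])
    then show ?thesis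
      using out(1,2) unfolding connected_center_clustering_def by blast
  qed
  then show ?thesis using run_time unfolding approximates_center_def by blast
qed

end

theorem theorem23:
  shows "(\<exists>(A :: com) (\<alpha> :: nat \<Rightarrow> real) (p :: nat poly).
            \<alpha> \<in> O(\<lambda>m. 2 ^ (3 * m)) \<and>
            (\<forall>(X :: 'a set) d E k xs.
               clustering_instance X d E k \<and> distinct xs \<and> set xs = X \<longrightarrow>
               approximates_center A (\<alpha> (doubling_dim X d)) (poly p (card X)) xs d E k)) \<and>
         (\<exists>(A :: com) (\<alpha> :: nat \<Rightarrow> real) (p :: nat poly).
            \<alpha> \<in> O(\<lambda>m. 2 ^ (3 * m)) \<and>
            (\<forall>(X :: 'a set) d E k xs.
               clustering_instance X d E k \<and> distinct xs \<and> set xs = X \<longrightarrow>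
               approximates_diameter A (\<alpha> (doubling_dim X d)) (poly p (card X)) xs d E k))"
proof (intro conjI)
  have bigo: "(\<lambda>m. c * 2 ^ (3 * m)) \<in> O(\<lambda>m. 2 ^ (3 * m))" for c :: real
    by simp
  have input: "clustering_input xs d E k"
    if "clustering_instance X d E k \<and> distinct xs \<and> set xs = X" for X :: "'a set" and d E k xs
    using that by (auto simp: clustering_input_def)
  show "\<exists>(A :: com) (\<alpha> :: nat \<Rightarrow> real) (p :: nat poly).
      \<alpha> \<in> O(\<lambda>m. 2 ^ (3 * m)) \<and>
      (\<forall>(X :: 'a set) d E k xs.
         clustering_instance X d E k \<and> distinct xs \<and> set xs = X \<longrightarrow>
         approximates_center A (\<alpha> (doubling_dim X d)) (poly p (card X)) xs d E k)"
    \<comment> \<open>32 is twice the 16 in \<open>factor\<close>.\<close>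
    using clustering_input.approximates_center[OF input] bigo[of 32]
    by (intro exI[of _ "compile cluster_prog"] exI[of _ "\<lambda>m. 32 * 2 ^ (3 * m)"]
        exI[of _ "cost cluster_prog"]) auto
  show "\<exists>(A :: com) (\<alpha> :: nat \<Rightarrow> real) (p :: nat poly).
      \<alpha> \<in> O(\<lambda>m. 2 ^ (3 * m)) \<and>
      (\<forall>(X :: 'a set) d E k xs.
         clustering_instance X d E k \<and> distinct xs \<and> set xs = X \<longrightarrow>
         approximates_diameter A (\<alpha> (doubling_dim X d)) (poly p (card X)) xs d E k)"
    using clustering_input.approximates_diameter[OF input] bigo[of 16]
    by (intro exI[of _ "compile cluster_prog"] exI[of _ "\<lambda>m. 16 * 2 ^ (3 * m)"]
        exI[of _ "cost cluster_prog"]) auto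
qed

end
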